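(* Let $n\ge 2$ and let $B(0,1)\subset\mathbf{R}^n$ be the open unit ball. There exist a function $u \in W^{1,1}_{\mathrm{loc}}(B(0,1))$ and an elliptic $A \in C(B(0,1); \mathbf{R}^{n \times n})$ such that $u$ is a weak solution of $-\operatorname{div}(A\nabla u)=0$ in $B(0,1)$, $Du\in (L\log L)_{\mathrm{loc}}(B(0,1))$, but for every $p>1$, $u \notin W^{1,p}_{\mathrm{loc}}(B(0,1))$.
   Context: Functions are real-valued. For an open set $\Omega\subset\mathbf{R}^n$, a bounded measurable map $A:\Omega\to\mathbf{R}^{n\times n}$ is called elliptic if $A(x)$ is a symmetric matrix for every $x\in\Omega$ and there exist constants $\lambda,\Lambda>0$ such that $\lambda|\xi|^2\le (A(x)\xi)\cdot\xi\le\Lambda|\xi|^2$ for every $x\in\Omega$ and $\xi\in\mathbf{R}^n$. A function $u\in W^{1,1}_{\mathrm{loc}}(\Omega)$ is a weak solution of $-\operatorname{div}(A\nabla u)=0$ in $\Omega$ if $\int_\Omega (A\nabla u)\cdot\nabla\varphi=0$ for every $\varphi\in C^1_c(\Omega)$. $Du$ denotes the weak gradient of $u$. A measurable (vector-valued) function $f$ belongs to $(L\log L)_{\mathrm{loc}}(\Omega)$ if $\int_K |f|\log(1+|f|)<\infty$ for every compact $K\subset\Omega$. *)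

theory Defs
  imports "HOL-Analysis.Analysis"
begin

definition gradient :: "('a::real_inner \<Rightarrow> real) \<Rightarrow> 'a \<Rightarrow> 'a" where
  "gradient f x = (THE D. GDERIV f x :> D)"

text \<open>Elements of \<open>C\<^sup>1\<^sub>c(\<Omega>)\<close> are represented by their extension by zero to the whole space.\<close>

definition C1c :: "'a::euclidean_space set \<Rightarrow> ('a \<Rightarrow> real) set" where
  "C1c \<Omega> = {\<phi>. (\<forall>x. \<phi> differentiable at x) \<and> continuous_on UNIV (gradient \<phi>) \<and>
     compact (closure {x. \<phi> x \<noteq> 0}) \<and> closure {x. \<phi> x \<noteq> 0} \<subseteq> \<Omega>}"

definition Lp_loc :: "real \<Rightarrow> 'a::euclidean_space set \<Rightarrow> ('a \<Rightarrow> 'b::euclidean_space) set" where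
  "Lp_loc p \<Omega> = {f \<in> borel_measurable (lebesgue_on \<Omega>).
     \<forall>K. compact K \<and> K \<subseteq> \<Omega> \<longrightarrow> integrable (lebesgue_on K) (\<lambda>x. norm (f x) powr p)}"

definition LlogL_loc :: "'a::euclidean_space set \<Rightarrow> ('a \<Rightarrow> 'b::euclidean_space) set" where
  "LlogL_loc \<Omega> = {f \<in> borel_measurable (lebesgue_on \<Omega>).
     \<forall>K. compact K \<and> K \<subseteq> \<Omega> \<longrightarrow>
       integrable (lebesgue_on K) (\<lambda>x. norm (f x) * ln (1 + norm (f x)))}"

text \<open>As in Gilbarg and Trudinger, first-order weak derivatives are tested against
  \<open>C\<^sup>1\<^sub>c\<close>, the class also used below for weak solutions.\<close>

definition has_weak_gradient ::
  "'a::euclidean_space set \<Rightarrow> ('a \<Rightarrow> real) \<Rightarrow> ('a \<Rightarrow> 'a) \<Rightarrow> bool" where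
  "has_weak_gradient \<Omega> u g \<longleftrightarrow> u \<in> Lp_loc 1 \<Omega> \<and> g \<in> Lp_loc 1 \<Omega> \<and>
     (\<forall>\<phi>\<in>C1c \<Omega>. \<forall>i\<in>Basis.
        (LINT x|lebesgue_on \<Omega>. u x * (gradient \<phi> x \<bullet> i)) =
        - (LINT x|lebesgue_on \<Omega>. (g x \<bullet> i) * \<phi> x))"

text \<open>A representative is chosen: on an open \<open>\<Omega>\<close> the weak gradient is unique only up to null sets.\<close>

definition weak_gradient :: "'a::euclidean_space set \<Rightarrow> ('a \<Rightarrow> real) \<Rightarrow> 'a \<Rightarrow> 'a" where
  "weak_gradient \<Omega> u = (SOME g. has_weak_gradient \<Omega> u g)"

definition W1p_loc :: "real \<Rightarrow> 'a::euclidean_space set \<Rightarrow> ('a \<Rightarrow> real) set" where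
  "W1p_loc p \<Omega> = {u \<in> Lp_loc p \<Omega>. \<exists>g \<in> Lp_loc p \<Omega>. has_weak_gradient \<Omega> u g}"

definition elliptic :: "(real^'n) set \<Rightarrow> (real^'n \<Rightarrow> real^'n^'n) \<Rightarrow> bool" where
  "elliptic \<Omega> A \<longleftrightarrow> A \<in> borel_measurable (lebesgue_on \<Omega>) \<and> bounded (A ` \<Omega>) \<and>
     (\<forall>x\<in>\<Omega>. transpose (A x) = A x) \<and>
     (\<exists>l>0. \<exists>L>0. \<forall>x\<in>\<Omega>. \<forall>\<xi>.
        l * (norm \<xi>)\<^sup>2 \<le> (A x *v \<xi>) \<bullet> \<xi> \<and> (A x *v \<xi>) \<bullet> \<xi> \<le> L * (norm \<xi>)\<^sup>2)"

definition weak_solution ::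
  "(real^'n) set \<Rightarrow> (real^'n \<Rightarrow> real^'n^'n) \<Rightarrow> (real^'n \<Rightarrow> real) \<Rightarrow> bool" where
  "weak_solution \<Omega> A u \<longleftrightarrow> u \<in> W1p_loc 1 \<Omega> \<and>
     (\<forall>\<phi>\<in>C1c \<Omega>.
        (LINT x|lebesgue_on \<Omega>. (A x *v weak_gradient \<Omega> u x) \<bullet> gradient \<phi> x) = 0)"

end

theory Submission
  imports Defs "HOL-Real_Asymp.Real_Asymp"
begin

text \<open>
  Write \<open>n\<close> for the dimension, \<open>s = |x|\<^sup>2\<close>, \<open>L = 24 - ln s\<close>, and let \<open>e\<close> be a unit vector. The solution is
  \<open>u(x) = (x \<bullet> e) |x|^(-n) L^(-3)\<close>, up to a constant factor a derivative of the
  fundamental solution of the Laplacian, damped by logarithms. Its gradient has size \<open>|x|^(-n) L^(-3)\<close>. The logarithm of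
  the gradient has size \<open>L\<close>, and \<open>|x|^(-n) L^(-2)\<close> is integrable at the origin, so the gradient lies in
  \<open>L log L\<close>; no power of a logarithm, however, makes \<open>|x|^(-np)\<close> integrable for \<open>p > 1\<close>.

  The matrix \<open>A\<close> is the identity in the radial direction and a multiple \<open>\<beta>(s)\<close> of the identity in
  the tangential directions. Away from the origin the equation is then an ordinary differential
  identity that can be solved for \<open>\<beta>\<close>, with the result
  \<open>\<beta> = 1 - 6n / ((n - 1) L) + 48 / ((n - 1) L\<^sup>2)\<close>. As \<open>\<beta>\<close> tends to 1 at the origin, \<open>A\<close> is continuous, and
  since \<open>L\<close> is at least 24 in the unit ball, \<open>1/2 \<le> \<beta> \<le> 2\<close> there.

  The origin does not obstruct the weak formulations, although \<open>u\<close> is not a solution in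
  the energy space. Cut out the origin by functions \<open>\<eta>\<close> with \<open>|\<nabla>\<eta>| \<le> C / |x|\<close>; the error terms tend to zero by
  dominated convergence, for the gradient because \<open>|u| / |x|\<close> is integrable
  (\<open>integration_by_parts_across_0\<close>), and for the flux \<open>A \<nabla>u\<close> because it is an even field, so that
  only the odd part of a test function enters the error term (\<open>even_divergence_free_across_0\<close>).

  As weak gradients are determined up to null sets (\<open>has_weak_gradient_unique\<close>), these facts about the
  pointwise gradient of \<open>u\<close> hold for every weak gradient.
\<close>

section \<open>Test functions\<close>

lemma differentiable_imp_GDERIV:
  fixes f :: "'a::euclidean_space \<Rightarrow> real"
  assumes "f differentiable at x"
  shows "\<exists>D. GDERIV f x :> D"
proof -
  obtain f' where f': "(f has_derivative f') (at x)"
    using assms unfolding differentiable_def by blast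
  then have lin: "bounded_linear f'" by (rule has_derivative_bounded_linear)
  have "f' h = h \<bullet> (\<Sum>i\<in>Basis. f' i *\<^sub>R i)" for h
  proof -
    have "f' h = f' (\<Sum>i\<in>Basis. (h \<bullet> i) *\<^sub>R i)" by (simp add: euclidean_representation)
    also have "\<dots> = (\<Sum>i\<in>Basis. (h \<bullet> i) * f' i)"
      using lin by (simp add: linear_sum linear_scale bounded_linear.linear)
    also have "\<dots> = h \<bullet> (\<Sum>i\<in>Basis. f' i *\<^sub>R i)"
      by (simp add: inner_sum_right mult.commute)
    finally show ?thesis .
  qed
  then have "f' = (\<lambda>h. h \<bullet> (\<Sum>i\<in>Basis. f' i *\<^sub>R i))" by blast
  with f' show ?thesis unfolding gderiv_def by metis
qed

lemma gradient_eqI: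
  fixes f :: "'a::euclidean_space \<Rightarrow> real"
  assumes "GDERIV f x :> D"
  shows "gradient f x = D"
proof -
  have "E = D" if "GDERIV f x :> E" for E
  proof -
    have "(\<lambda>h. h \<bullet> E) = (\<lambda>h. h \<bullet> D)"
      using that assms unfolding gderiv_def by (rule has_derivative_unique)
    then have "h \<bullet> E = h \<bullet> D" for h by metis
    then show ?thesis by (metis inner_commute vector_eq_rdot)
  qed
  with assms show ?thesis unfolding gradient_def by (rule the_equality)
qed

lemma GDERIV_const_outside:
  fixes f :: "'a::euclidean_space \<Rightarrow> real"
  assumes "closed K" "\<And>x. x \<notin> K \<Longrightarrow> f x = 0" "x \<notin> K"
  shows "GDERIV f x :> 0"
  unfolding gderiv_def inner_zero_right
  by (rule has_derivative_transform_within_open[where s = "-K", OF has_derivative_const[of 0]])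
    (use assms in auto)

lemma GDERIV_unique:
  fixes f :: "'a::euclidean_space \<Rightarrow> real"
  assumes "GDERIV f x :> D" "GDERIV f x :> E"
  shows "D = E"
  using assms by (metis gradient_eqI)

lemma GDERIV_isCont: "GDERIV f x :> D \<Longrightarrow> isCont f x"
  unfolding gderiv_def by (rule has_derivative_continuous)

lemma GDERIV_continuous_on: "(\<And>x. x \<in> S \<Longrightarrow> GDERIV f x :> G x) \<Longrightarrow> continuous_on S f"
  by (intro continuous_at_imp_continuous_on) (blast intro: GDERIV_isCont)

lemma C1cI:
  fixes \<phi> :: "'a::euclidean_space \<Rightarrow> real"
  assumes G: "\<And>x. GDERIV \<phi> x :> G x" and cont: "continuous_on UNIV G"
    and K: "compact K" "K \<subseteq> \<Omega>" "\<And>x. x \<notin> K \<Longrightarrow> \<phi> x = 0"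
  shows "\<phi> \<in> C1c \<Omega>"
proof -
  have eq: "gradient \<phi> = G" using G gradient_eqI by blast
  have sub: "closure {x. \<phi> x \<noteq> 0} \<subseteq> K"
    using K by (intro closure_minimal) (auto simp: compact_imp_closed)
  then have "compact (closure {x. \<phi> x \<noteq> 0})"
    using K(1) by (metis closed_closure compact_Int_closed inf.absorb_iff2)
  moreover have "\<phi> differentiable at x" for x
    using G[of x] unfolding gderiv_def differentiable_def by blast
  ultimately show ?thesis using cont sub K(2) by (auto simp: C1c_def eq)
qed

lemma C1c_GDERIV:
  fixes \<phi> :: "'a::euclidean_space \<Rightarrow> real"
  assumes "\<phi> \<in> C1c \<Omega>"
  shows "GDERIV \<phi> x :> gradient \<phi> x"
  using assms differentiable_imp_GDERIV[of \<phi> x] gradient_eqI unfolding C1c_def by auto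

lemma C1c_continuous:
  fixes \<phi> :: "'a::euclidean_space \<Rightarrow> real"
  assumes "\<phi> \<in> C1c \<Omega>"
  shows "continuous_on UNIV \<phi>" "continuous_on UNIV (gradient \<phi>)"
  using GDERIV_continuous_on[OF C1c_GDERIV[OF assms], of UNIV] assms by (auto simp: C1c_def)

lemma C1c_support:
  fixes \<phi> :: "'a::euclidean_space \<Rightarrow> real"
  assumes "\<phi> \<in> C1c \<Omega>"
  shows "\<exists>K. compact K \<and> K \<subseteq> \<Omega> \<and> (\<forall>x. x \<notin> K \<longrightarrow> \<phi> x = 0 \<and> gradient \<phi> x = 0)"
proof (intro exI conjI allI impI)
  let ?K = "closure {x. \<phi> x \<noteq> 0}"
  have z: "\<phi> x = 0" if "x \<notin> ?K" for x
    using that closure_subset[of "{x. \<phi> x \<noteq> 0}"] by auto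
  show "compact ?K" "?K \<subseteq> \<Omega>" using assms by (auto simp: C1c_def)
  fix x assume x: "x \<notin> ?K"
  show "\<phi> x = 0" by (rule z[OF x])
  show "gradient \<phi> x = 0"
    by (rule gradient_eqI, rule GDERIV_const_outside[OF closed_closure z x])
qed

section \<open>Integration by parts\<close>

lemma continuous_on_UNIV_compact_support_imp_integrable:
  fixes f :: "'a::euclidean_space \<Rightarrow> 'b::euclidean_space"
  assumes "continuous_on UNIV f" "compact K" "\<And>x. x \<notin> K \<Longrightarrow> f x = 0"
  shows "integrable lborel f"
proof -
  have "integrable lborel (\<lambda>x. indicator K x *\<^sub>R f x)"
    by (rule borel_integrable_compact) (use assms continuous_on_subset[of UNIV f K] in auto)
  moreover have "(\<lambda>x. indicator K x *\<^sub>R f x) = f"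
    using assms(3) by (auto simp: indicator_def)
  ultimately show ?thesis by simp
qed

lemma compact_support_bounded:
  fixes f :: "'a::euclidean_space \<Rightarrow> 'b::euclidean_space"
  assumes "continuous_on UNIV f" "compact K" "\<And>x. x \<notin> K \<Longrightarrow> f x = 0"
  obtains M where "0 \<le> M" "\<And>x. norm (f x) \<le> M"
proof -
  have "compact (f ` K)"
    using assms continuous_on_subset[of UNIV f K] by (intro compact_continuous_image) auto
  then obtain M where "\<And>y. y \<in> f ` K \<Longrightarrow> norm y \<le> M"
    using compact_imp_bounded bounded_iff by metis
  then have "norm (f x) \<le> max M 0" for x
    using assms(3)[of x] by (cases "x \<in> K") (auto simp: le_max_iff_disj)
  then show ?thesis using that[of "max M 0"] by simp
qed

text \<open>The integral of \<open>f\<close> is invariant under translation, so all difference quotients of \<open>f\<close>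
  have integral zero; they converge boundedly to the directional derivative.\<close>

lemma integral_gradient_compact_support:
  fixes f :: "'a::euclidean_space \<Rightarrow> real"
  assumes G: "\<And>x. GDERIV f x :> G x" and cont: "continuous_on UNIV G"
    and K: "compact K" "\<And>x. x \<notin> K \<Longrightarrow> f x = 0"
  shows "(\<integral>x. G x \<bullet> v \<partial>lborel) = 0"
proof -
  have contf: "continuous_on UNIV f"
    using G by (rule GDERIV_continuous_on)
  have G0: "G x = 0" if "x \<notin> K" for x
    using GDERIV_unique[OF G GDERIV_const_outside[of K f x]] K that compact_imp_closed by blast
  obtain M where M: "0 \<le> M" "\<And>x. norm (G x) \<le> M"
    by (rule compact_support_bounded[OF cont K(1) G0]) auto
  obtain R where R: "\<And>x. x \<in> K \<Longrightarrow> norm x \<le> R"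
    using K(1) compact_imp_bounded bounded_iff by metis
  define h where "h k = 1 / real (Suc k)" for k
  have h: "0 < h k" "h k \<le> 1" for k by (auto simp: h_def)
  define q where "q k x = (f (x + h k *\<^sub>R v) - f x) / h k" for k x
  have line: "((\<lambda>t. f (x + t *\<^sub>R v)) has_real_derivative G (x + t *\<^sub>R v) \<bullet> v) (at t)" for x t
  proof -
    have "((\<lambda>t. f (x + t *\<^sub>R v)) has_derivative (\<lambda>s. (s *\<^sub>R v) \<bullet> G (x + t *\<^sub>R v))) (at t)"
      using G[of "x + t *\<^sub>R v"] unfolding gderiv_def
      by (rule has_derivative_compose[rotated]) (auto intro!: derivative_eq_intros)
    moreover have "(\<lambda>s. (s *\<^sub>R v) \<bullet> G (x + t *\<^sub>R v)) = (*) (G (x + t *\<^sub>R v) \<bullet> v)"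
      by (auto simp: inner_commute)
    ultimately show ?thesis unfolding has_field_derivative_def by simp
  qed
  have int_f: "integrable lborel f"
    by (rule continuous_on_UNIV_compact_support_imp_integrable[OF contf K])
  have shift: "integrable lborel (\<lambda>x. f (x + c))" "(\<integral>x. f (x + c) \<partial>lborel) = integral\<^sup>L lborel f" for c
  proof -
    have [measurable]: "f \<in> borel_measurable borel" using contf by (rule borel_measurable_continuous_onI)
    have d: "distr lborel borel ((+) c) = (lborel :: 'a measure)" by (rule lborel_distr_plus)
    have "integrable (distr lborel borel ((+) c)) f" unfolding d by (rule int_f)
    then show "integrable lborel (\<lambda>x. f (x + c))"
      by (subst (asm) integrable_distr_eq) (auto simp: add.commute)
    have "integral\<^sup>L (distr lborel borel ((+) c)) f = (\<integral>x. f (x + c) \<partial>lborel)"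
      by (subst integral_distr) (auto simp: add.commute)
    then show "(\<integral>x. f (x + c) \<partial>lborel) = integral\<^sup>L lborel f" unfolding d by simp
  qed
  have q0: "integral\<^sup>L lborel (q k) = 0" for k
    unfolding q_def using shift int_f by simp
  have bound: "norm (q k x) \<le> indicator (cball 0 (R + norm v)) x *\<^sub>R (M * norm v)" for k x
  proof (cases "x \<in> cball 0 (R + norm v)")
    case True
    obtain z where "f (x + h k *\<^sub>R v) - f (x + 0 *\<^sub>R v) = (h k - 0) * (G (x + z *\<^sub>R v) \<bullet> v)"
      using MVT2[of 0 "h k" "\<lambda>t. f (x + t *\<^sub>R v)" "\<lambda>t. G (x + t *\<^sub>R v) \<bullet> v"] line h by blast
    then have "q k x = G (x + z *\<^sub>R v) \<bullet> v" using h[of k] by (simp add: q_def)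
    then have "norm (q k x) \<le> norm (G (x + z *\<^sub>R v)) * norm v"
      by (simp add: Cauchy_Schwarz_ineq2)
    also have "\<dots> \<le> M * norm v" using M by (intro mult_right_mono) auto
    finally show ?thesis using True by simp
  next
    case False
    have "norm (h k *\<^sub>R v) \<le> norm v" using h[of k] by (simp add: mult_left_le_one_le)
    moreover have "norm x \<le> norm (x + h k *\<^sub>R v) + norm (h k *\<^sub>R v)"
      by (metis add_diff_cancel_right' norm_triangle_ineq4)
    ultimately have "norm (x + h k *\<^sub>R v) > R" "norm x > R"
      using False norm_ge_zero[of v] by (simp_all only: mem_cball_0 not_le)
    then have "f (x + h k *\<^sub>R v) = 0" "f x = 0" using R K(2) by (meson not_le)+
    then show ?thesis using False by (simp add: q_def)
  qed
  have lim: "(\<lambda>k. q k x) \<longlonglongrightarrow> G x \<bullet> v" for x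
  proof -
    have "((\<lambda>t. (f (x + t *\<^sub>R v) - f (x + 0 *\<^sub>R v)) / (t - 0)) \<longlongrightarrow> G (x + 0 *\<^sub>R v) \<bullet> v) (at 0)"
      using line[of x 0] unfolding has_field_derivative_iff by auto
    moreover have "h \<longlonglongrightarrow> 0" unfolding h_def by (rule LIMSEQ_Suc[OF lim_1_over_n])
    then have "filterlim h (at 0) sequentially"
      using h by (auto simp: filterlim_at intro!: always_eventually) (metis less_irrefl)
    ultimately show ?thesis unfolding q_def using filterlim_compose by fastforce
  qed
  have "(\<lambda>k. integral\<^sup>L lborel (q k)) \<longlonglongrightarrow> (\<integral>x. G x \<bullet> v \<partial>lborel)"
  proof (rule integral_dominated_convergence)
    show "(\<lambda>x. G x \<bullet> v) \<in> borel_measurable lborel"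
      using cont by (auto intro!: borel_measurable_continuous_onI continuous_intros)
    show "q k \<in> borel_measurable lborel" for k
      unfolding q_def using borel_measurable_integrable[OF shift(1)] borel_measurable_integrable[OF int_f]
      by simp
    show "integrable lborel (\<lambda>x. indicator (cball 0 (R + norm v)) x *\<^sub>R (M * norm v))"
      by (rule borel_integrable_compact) auto
  qed (use bound lim in auto)
  then show ?thesis by (simp add: q0 LIMSEQ_const_iff)
qed

lemma continuous_on_times_compact_support:
  fixes h :: "'a::euclidean_space \<Rightarrow> 'b::real_normed_vector" and \<psi> :: "'a \<Rightarrow> real"
  assumes "open U" "continuous_on U h" "continuous_on UNIV \<psi>"
    and K: "compact K" "K \<subseteq> U" "\<And>x. x \<notin> K \<Longrightarrow> \<psi> x = 0"
  shows "continuous_on UNIV (\<lambda>x. \<psi> x *\<^sub>R h x)"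
proof -
  have "continuous_on U (\<lambda>x. \<psi> x *\<^sub>R h x)"
    using assms(2) continuous_on_subset[OF assms(3), of U] by (intro continuous_intros) auto
  moreover have "continuous_on (-K) (\<lambda>x. \<psi> x *\<^sub>R h x)"
    by (rule continuous_on_eq[of _ "\<lambda>x. 0"]) (use K in auto)
  moreover have "open (-K)" using K(1) by (simp add: compact_imp_closed open_Compl)
  ultimately have "continuous_on (U \<union> - K) (\<lambda>x. \<psi> x *\<^sub>R h x)"
    using assms(1) by (intro continuous_on_open_Un)
  moreover have "U \<union> - K = UNIV" using K by auto
  ultimately show ?thesis by simp
qed

lemma C1_integration_by_parts:
  fixes w :: "'a::euclidean_space \<Rightarrow> real"
  assumes U: "open U" and W: "\<And>x. x \<in> U \<Longrightarrow> GDERIV w x :> W x" and cont: "continuous_on U W"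
    and \<psi>: "\<psi> \<in> C1c U"
  shows "integrable lebesgue (\<lambda>x. w x * (gradient \<psi> x \<bullet> v))"
    and "integrable lebesgue (\<lambda>x. (W x \<bullet> v) * \<psi> x)"
    and "(\<integral>x. w x * (gradient \<psi> x \<bullet> v) \<partial>lebesgue) = - (\<integral>x. (W x \<bullet> v) * \<psi> x \<partial>lebesgue)"
proof -
  obtain K where K: "compact K" "K \<subseteq> U" and \<psi>0: "\<And>x. x \<notin> K \<Longrightarrow> \<psi> x = 0"
    and g0: "\<And>x. x \<notin> K \<Longrightarrow> gradient \<psi> x = 0"
    using C1c_support[OF \<psi>] by auto
  note D = C1c_GDERIV[OF \<psi>] and c = C1c_continuous[OF \<psi>]
  have cw: "continuous_on U w"
    using W by (rule GDERIV_continuous_on)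
  have c1: "continuous_on UNIV (\<lambda>x. w x * (gradient \<psi> x \<bullet> v))" for v
    using continuous_on_times_compact_support[OF U cw
        continuous_on_inner[OF c(2) continuous_on_const[of _ v]] K] g0
    by (simp add: mult.commute)
  have c2: "continuous_on UNIV (\<lambda>x. (W x \<bullet> v) * \<psi> x)" for v
    using continuous_on_times_compact_support[OF U
        continuous_on_inner[OF cont continuous_on_const[of _ v]] c(1) K] \<psi>0
    by (simp add: mult.commute)
  have i1: "integrable lborel (\<lambda>x. w x * (gradient \<psi> x \<bullet> v))"
    by (rule continuous_on_UNIV_compact_support_imp_integrable[OF c1 K(1)]) (auto simp: g0)
  have i2: "integrable lborel (\<lambda>x. (W x \<bullet> v) * \<psi> x)"
    by (rule continuous_on_UNIV_compact_support_imp_integrable[OF c2 K(1)]) (auto simp: \<psi>0)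
  have m1: "(\<lambda>x. w x * (gradient \<psi> x \<bullet> v)) \<in> borel_measurable lborel"
    using c1[of v] by (simp add: borel_measurable_continuous_onI)
  have m2: "(\<lambda>x. (W x \<bullet> v) * \<psi> x) \<in> borel_measurable lborel"
    using c2[of v] by (simp add: borel_measurable_continuous_onI)
  show "integrable lebesgue (\<lambda>x. w x * (gradient \<psi> x \<bullet> v))"
    using integrable_completion[OF m1] i1 by simp
  show "integrable lebesgue (\<lambda>x. (W x \<bullet> v) * \<psi> x)"
    using integrable_completion[OF m2] i2 by simp
  define G where "G x = w x *\<^sub>R gradient \<psi> x + \<psi> x *\<^sub>R W x" for x
  have "(\<integral>x. G x \<bullet> v \<partial>lborel) = 0"
  proof (rule integral_gradient_compact_support)
    show "GDERIV (\<lambda>x. w x * \<psi> x) x :> G x" for x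
    proof (cases "x \<in> K")
      case True
      then show ?thesis unfolding G_def using GDERIV_mult[OF W D] K by blast
    next
      case False
      then have "G x = 0" by (simp add: G_def g0 \<psi>0)
      then show ?thesis
        using GDERIV_const_outside[of K "\<lambda>x. w x * \<psi> x" x] False K \<psi>0 compact_imp_closed by auto
    qed
    have "continuous_on UNIV (\<lambda>x. w x *\<^sub>R gradient \<psi> x)"
    proof (rule continuous_on_componentwise[THEN iffD2], rule ballI)
      show "continuous_on UNIV (\<lambda>x. (w x *\<^sub>R gradient \<psi> x) \<bullet> i)" for i
        using c1[of i] by simp
    qed
    moreover have "continuous_on UNIV (\<lambda>x. \<psi> x *\<^sub>R W x)"
      by (rule continuous_on_times_compact_support[OF U cont c(1) K \<psi>0])
    ultimately show "continuous_on UNIV G" unfolding G_def by (rule continuous_on_add)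
    show "w x * \<psi> x = 0" if "x \<notin> K" for x using \<psi>0 that by simp
  qed (rule K)
  moreover have "G x \<bullet> v = w x * (gradient \<psi> x \<bullet> v) + (W x \<bullet> v) * \<psi> x" for x
    by (simp add: G_def inner_add_left mult.commute)
  ultimately have "(\<integral>x. w x * (gradient \<psi> x \<bullet> v) \<partial>lborel) + (\<integral>x. (W x \<bullet> v) * \<psi> x \<partial>lborel) = 0"
    using i1 i2 by simp
  then show "(\<integral>x. w x * (gradient \<psi> x \<bullet> v) \<partial>lebesgue) = - (\<integral>x. (W x \<bullet> v) * \<psi> x \<partial>lebesgue)"
    unfolding integral_completion[OF m1] integral_completion[OF m2] by simp
qed

section \<open>Uniqueness of weak gradients\<close>

lemma continuous_imp_lebesgue_measurable:
  fixes f :: "'a::euclidean_space \<Rightarrow> 'b::topological_space"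
  assumes "continuous_on UNIV f"
  shows "f \<in> borel_measurable lebesgue"
  using borel_measurable_continuous_onI[OF assms] by (intro measurable_completion) simp

lemma compact_subsets_negligible_imp_negligible:
  fixes S :: "'a::euclidean_space set"
  assumes S: "S \<in> sets lebesgue" and K: "\<And>K. compact K \<Longrightarrow> K \<subseteq> S \<Longrightarrow> negligible K"
  shows "negligible S"
proof -
  obtain C T where CT: "fsigma C" "T \<in> null_sets lebesgue" "C \<union> T = S" "disjnt C T"
    using lebesgue_set_almost_fsigma[OF S] by metis
  obtain F :: "nat \<Rightarrow> 'a set" where F: "range F \<subseteq> Collect compact" "C = \<Union>(range F)"
    using CT(1) fsigma_Union_compact by metis
  have "negligible (F n)" for n
    by (rule K) (use F CT in blast)+
  then have "negligible C" unfolding F(2) by (rule negligible_Union_nat)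
  then show ?thesis using CT negligible_Un negligible_iff_null_sets by blast
qed

text \<open>On a compact set \<open>K \<subseteq> {h > 0}\<close> the integral of \<open>h\<close> vanishes, because the indicator
  of \<open>K\<close> is a bounded pointwise limit of continuous functions; hence \<open>K\<close> is a null set.\<close>

lemma orthogonal_to_continuous_imp_negligible_pos:
  fixes h :: "'a::euclidean_space \<Rightarrow> real"
  assumes h: "integrable lebesgue h"
    and orth: "\<And>f. continuous_on UNIV f \<Longrightarrow> (\<integral>x. f x * h x \<partial>lebesgue) = 0"
  shows "negligible {x. h x > 0}"
proof (rule compact_subsets_negligible_imp_negligible)
  have [measurable]: "h \<in> borel_measurable lebesgue" using h by simp
  have "{x \<in> space lebesgue. h x > 0} \<in> sets lebesgue" by measurable
  then show "{x. h x > 0} \<in> sets lebesgue" by simp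
  fix K assume K: "compact K" "K \<subseteq> {x. h x > 0}"
  show "negligible K"
  proof (cases "K = {}")
    case False
    have Kl [measurable]: "K \<in> sets lebesgue" using K(1) by (simp add: compact_imp_closed)
    define f where "f k x = max 0 (1 - real k * infdist x K)" for k x
    have f01: "0 \<le> f k x" "f k x \<le> 1" for k x by (auto simp: f_def infdist_nonneg)
    have cf: "continuous_on UNIV (f k)" for k unfolding f_def by (intro continuous_intros)
    have fl: "(\<lambda>k. f k x) \<longlonglongrightarrow> indicator K x" for x
    proof (cases "x \<in> K")
      case True
      then show ?thesis by (simp add: f_def)
    next
      case nK: False
      then have i0: "infdist x K > 0"
        using in_closed_iff_infdist_zero[of K x] K False infdist_nonneg[of x K]
        by (metis compact_imp_closed less_eq_real_def)
      have "\<forall>\<^sub>F k in sequentially. f k x = 0"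
        using eventually_gt_at_top[of "nat \<lceil>1 / infdist x K\<rceil>"]
      proof eventually_elim
        case (elim k)
        then have "1 / infdist x K \<le> real k" by linarith
        then show ?case using i0 by (simp add: f_def field_simps)
      qed
      then show ?thesis using nK by (simp add: tendsto_eventually)
    qed
    have "(\<lambda>k. \<integral>x. f k x * h x \<partial>lebesgue) \<longlonglongrightarrow> (\<integral>x. indicator K x * h x \<partial>lebesgue)"
    proof (rule integral_dominated_convergence[where w = "\<lambda>x. \<bar>h x\<bar>"])
      show "(\<lambda>x. f k x * h x) \<in> borel_measurable lebesgue" for k
        using continuous_imp_lebesgue_measurable[OF cf[of k]] by (intro borel_measurable_times) auto
      show "AE x in lebesgue. (\<lambda>k. f k x * h x) \<longlonglongrightarrow> indicator K x * h x"
        using fl by (auto intro!: tendsto_mult)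
      show "AE x in lebesgue. norm (f k x * h x) \<le> \<bar>h x\<bar>" for k
        using f01[of k] by (auto simp: abs_mult mult_left_le_one_le)
    qed (use h in auto)
    then have "(\<integral>x. indicator K x * h x \<partial>lebesgue) = 0"
      by (simp add: orth[OF cf] LIMSEQ_const_iff)
    moreover have "integrable lebesgue (\<lambda>x. indicator K x * h x)"
      using integrable_mult_indicator[OF Kl h] by simp
    moreover have "0 \<le> indicator K x * h x" for x using K(2) by (auto simp: indicator_def)
    ultimately have "AE x in lebesgue. indicator K x * h x = 0"
      using integral_nonneg_eq_0_iff_AE by blast
    then have "AE x in lebesgue. x \<notin> K"
      by eventually_elim (use K(2) in \<open>auto simp: indicator_def split: if_splits\<close>)
    then have "K \<in> null_sets lebesgue" using Kl by (simp add: AE_iff_null_sets)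
    then show ?thesis by (simp add: negligible_iff_null_sets)
  qed simp
qed

lemma orthogonal_to_continuous_imp_negligible:
  fixes h :: "'a::euclidean_space \<Rightarrow> real"
  assumes h: "integrable lebesgue h"
    and orth: "\<And>f. continuous_on UNIV f \<Longrightarrow> (\<integral>x. f x * h x \<partial>lebesgue) = 0"
  shows "negligible {x. h x \<noteq> 0}"
proof -
  have "negligible {x. - h x > 0}"
    by (rule orthogonal_to_continuous_imp_negligible_pos) (use h orth in auto)
  moreover have "negligible {x. h x > 0}"
    by (rule orthogonal_to_continuous_imp_negligible_pos) (use h orth in auto)
  moreover have "{x. h x \<noteq> 0} = {x. h x > 0} \<union> {x. - h x > 0}" by auto
  ultimately show ?thesis by simp
qed

lemma Lp_loc_1_integrable:
  assumes "f \<in> Lp_loc 1 \<Omega>" "compact K" "K \<subseteq> \<Omega>"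
  shows "integrable (lebesgue_on K) f"
proof -
  have "f \<in> borel_measurable (lebesgue_on K)"
    using assms by (auto simp: Lp_loc_def intro: measurable_restrict_mono)
  moreover have "integrable (lebesgue_on K) (\<lambda>x. norm (f x))"
    using assms by (simp add: Lp_loc_def)
  ultimately show ?thesis by (simp add: integrable_norm_iff)
qed

lemma Lp_loc_1_times_compact_support:
  fixes f :: "'a::euclidean_space \<Rightarrow> 'b::euclidean_space"
  assumes \<Omega>: "open \<Omega>" and f: "f \<in> Lp_loc 1 \<Omega>" and \<psi>: "continuous_on UNIV \<psi>"
    and K: "compact K" "K \<subseteq> \<Omega>" "\<And>x. x \<notin> K \<Longrightarrow> \<psi> x = 0"
  shows "integrable (lebesgue_on \<Omega>) (\<lambda>x. \<psi> x *\<^sub>R f x)"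
proof -
  obtain M where M: "0 \<le> M" "\<And>x. norm (\<psi> x) \<le> M"
    by (rule compact_support_bounded[OF \<psi> K(1) K(3)]) auto
  have fK: "integrable (lebesgue_on K) f" by (rule Lp_loc_1_integrable[OF f K(1,2)])
  have "integrable (lebesgue_on K) (\<lambda>x. \<psi> x *\<^sub>R f x)"
  proof (rule Bochner_Integration.integrable_bound)
    show "integrable (lebesgue_on K) (\<lambda>x. M *\<^sub>R f x)" using fK by simp
    have "\<psi> \<in> borel_measurable lebesgue" by (rule continuous_imp_lebesgue_measurable[OF \<psi>])
    then have "\<psi> \<in> borel_measurable (lebesgue_on K)" by (rule measurable_restrict_space1)
    then show "(\<lambda>x. \<psi> x *\<^sub>R f x) \<in> borel_measurable (lebesgue_on K)"
      using fK by (intro borel_measurable_scaleR) auto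
    show "AE x in lebesgue_on K. norm (\<psi> x *\<^sub>R f x) \<le> norm (M *\<^sub>R f x)"
      using M by (auto intro!: mult_right_mono)
  qed
  then have "integrable lebesgue (\<lambda>x. if x \<in> K then \<psi> x *\<^sub>R f x else 0)"
    using K(1) by (subst Lebesgue_Measure.integrable_restrict_UNIV) (auto simp: compact_imp_closed)
  moreover have "(\<lambda>x. if x \<in> K then \<psi> x *\<^sub>R f x else 0) = (\<lambda>x. if x \<in> \<Omega> then \<psi> x *\<^sub>R f x else 0)"
    using K by fastforce
  ultimately show ?thesis
    using Lebesgue_Measure.integrable_restrict_UNIV[of \<Omega> "\<lambda>x. \<psi> x *\<^sub>R f x"] \<Omega> by simp
qed

lemma real_polynomial_function_C1:
  fixes p :: "'a::euclidean_space \<Rightarrow> real"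
  assumes "real_polynomial_function p"
  shows "\<exists>P. (\<forall>x. GDERIV p x :> P x) \<and> continuous_on UNIV P"
  using assms
proof (induction rule: real_polynomial_function.induct)
  case (linear f)
  have "f = (\<lambda>x. x \<bullet> adjoint f 1)"
    using adjoint_works[of f _ 1] linear by (auto simp: bounded_linear.linear)
  moreover have "GDERIV (\<lambda>x. x \<bullet> y) x :> y" for x y :: 'a
    unfolding gderiv_def by (auto intro!: derivative_eq_intros)
  ultimately have "\<forall>x. GDERIV f x :> adjoint f 1" by metis
  then show ?case by (intro exI[of _ "\<lambda>x. adjoint f 1"]) simp
next
  case (const c)
  then show ?case using GDERIV_const by (intro exI[of _ "\<lambda>x. 0"]) auto
next
  case (add f g)
  then obtain F G where "\<forall>x. GDERIV f x :> F x" "continuous_on UNIV F"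
    "\<forall>x. GDERIV g x :> G x" "continuous_on UNIV G" by blast
  then show ?case
    by (intro exI[of _ "\<lambda>x. F x + G x"]) (auto intro: GDERIV_add continuous_on_add)
next
  case (mult f g)
  then obtain F G where *: "\<forall>x. GDERIV f x :> F x" "continuous_on UNIV F"
    "\<forall>x. GDERIV g x :> G x" "continuous_on UNIV G" by blast
  then have "continuous_on UNIV f" "continuous_on UNIV g" by (auto intro: GDERIV_continuous_on)
  with * show ?case
    by (intro exI[of _ "\<lambda>x. f x *\<^sub>R G x + g x *\<^sub>R F x"])
      (auto intro!: GDERIV_mult continuous_intros)
qed

lemma DERIV_max_0_power2: "((\<lambda>t::real. (max 0 t)\<^sup>2) has_real_derivative 2 * max 0 t) (at t)"
proof (cases "t = 0")
  case True
  have "((\<lambda>h::real. (max 0 h)\<^sup>2 / h) \<longlongrightarrow> 0) (at 0)"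
  proof (rule Lim_null_comparison)
    show "\<forall>\<^sub>F h::real in at 0. norm ((max 0 h)\<^sup>2 / h) \<le> \<bar>h\<bar>"
      by (intro always_eventually) (auto simp: max_def power2_eq_square)
    show "((\<lambda>h::real. \<bar>h\<bar>) \<longlongrightarrow> 0) (at 0)" by (rule tendsto_rabs_zero) (rule tendsto_ident_at)
  qed
  then show ?thesis using True by (simp add: has_field_derivative_iff)
next
  case False
  then consider "t > 0" | "t < 0" by linarith
  then show ?thesis
  proof cases
    case 1
    have "((\<lambda>t::real. t\<^sup>2) has_real_derivative 2 * t) (at t)" by (auto intro!: derivative_eq_intros)
    then have "((\<lambda>t::real. (max 0 t)\<^sup>2) has_real_derivative 2 * t) (at t)"
      by (rule has_field_derivative_transform_within_open[of _ _ _ "{0<..}"]) (use 1 in auto)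
    then show ?thesis using 1 by simp
  next
    case 2
    have "((\<lambda>t::real. 0) has_real_derivative 0) (at t)" by simp
    then have "((\<lambda>t::real. (max 0 t)\<^sup>2) has_real_derivative 0) (at t)"
      by (rule has_field_derivative_transform_within_open[of _ _ _ "{..<0}"]) (use 2 in auto)
    then show ?thesis using 2 by simp
  qed
qed

lemma GDERIV_norm_power2_shift: "GDERIV (\<lambda>x. (norm (x - c))\<^sup>2) x :> 2 *\<^sub>R (x - c)"
  unfolding power2_norm_eq_inner gderiv_def
  by (auto intro!: derivative_eq_intros simp: inner_commute)

lemma GDERIV_norm_power2: "GDERIV (\<lambda>x. (norm x)\<^sup>2) x :> 2 *\<^sub>R x"
  using GDERIV_norm_power2_shift[of 0 x] by simp

text \<open>Near a point \<open>c\<close> the function \<open>d\<close> is multiplied by a bump \<open>\<eta>\<close> that is positive on a ball around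
  \<open>c\<close>. Since \<open>\<eta>\<close> times a polynomial is a test function, \<open>\<eta> d\<close> is orthogonal to all polynomials,
  and by the theorem of Stone and Weierstrass to all continuous functions.\<close>

lemma fundamental_lemma_calculus_of_variations:
  fixes d :: "'a::euclidean_space \<Rightarrow> real"
  assumes \<Omega>: "open \<Omega>" and d: "d \<in> Lp_loc 1 \<Omega>"
    and orth: "\<And>\<phi>. \<phi> \<in> C1c \<Omega> \<Longrightarrow> (\<integral>x. d x * \<phi> x \<partial>lebesgue_on \<Omega>) = 0"
  shows "AE x in lebesgue_on \<Omega>. d x = 0"
proof -
  define N where "N = {x \<in> \<Omega>. d x \<noteq> 0}"
  have "\<exists>U. openin (top_of_set N) U \<and> c \<in> U \<and> negligible U" if c: "c \<in> N" for c
  proof -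
    obtain \<rho> where \<rho>: "\<rho> > 0" "cball c \<rho> \<subseteq> \<Omega>"
      using \<Omega> c open_contains_cball unfolding N_def by blast
    define \<eta> where "\<eta> x = (max 0 (\<rho>\<^sup>2 - (norm (x - c))\<^sup>2))\<^sup>2" for x
    define X where "X x = (2 * max 0 (\<rho>\<^sup>2 - (norm (x - c))\<^sup>2)) *\<^sub>R (0 - 2 *\<^sub>R (x - c))" for x
    have X: "GDERIV \<eta> x :> X x" for x
      unfolding \<eta>_def X_def
      by (rule GDERIV_DERIV_compose[OF GDERIV_diff[OF GDERIV_const GDERIV_norm_power2_shift]
            DERIV_max_0_power2])
    have cX: "continuous_on UNIV X" unfolding X_def by (intro continuous_intros)
    have c\<eta>: "continuous_on UNIV \<eta>" using X by (rule GDERIV_continuous_on)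
    have \<eta>0: "\<eta> x = 0" if "x \<notin> cball c \<rho>" for x
    proof -
      have "\<rho> \<le> norm (x - c)" using that by (simp add: dist_norm norm_minus_commute)
      then have "\<rho>\<^sup>2 \<le> (norm (x - c))\<^sup>2" using \<rho> by (intro power_mono) auto
      then show ?thesis by (simp add: \<eta>_def)
    qed
    define h where "h x = (if x \<in> \<Omega> then \<eta> x * d x else 0)" for x
    have "integrable (lebesgue_on \<Omega>) (\<lambda>x. \<eta> x *\<^sub>R d x)"
      by (rule Lp_loc_1_times_compact_support[OF \<Omega> d c\<eta> _ \<rho>(2) \<eta>0]) auto
    then have h: "integrable lebesgue h"
      unfolding h_def by (subst Lebesgue_Measure.integrable_restrict_UNIV) (use \<Omega> in auto)
    have poly: "(\<integral>x. p x * h x \<partial>lebesgue) = 0" if "real_polynomial_function p" for p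
    proof -
      obtain P where P: "\<And>x. GDERIV p x :> P x" "continuous_on UNIV P"
        using real_polynomial_function_C1[OF \<open>real_polynomial_function p\<close>] by blast
      then have cp: "continuous_on UNIV p" by (auto intro: GDERIV_continuous_on)
      have "(\<lambda>x. p x * \<eta> x) \<in> C1c \<Omega>"
      proof (rule C1cI)
        show "GDERIV (\<lambda>x. p x * \<eta> x) x :> p x *\<^sub>R X x + \<eta> x *\<^sub>R P x" for x
          by (rule GDERIV_mult[OF P(1) X])
        show "continuous_on UNIV (\<lambda>x. p x *\<^sub>R X x + \<eta> x *\<^sub>R P x)"
          using P(2) cX c\<eta> cp by (intro continuous_intros)
      qed (use \<rho>(2) \<eta>0 in auto)
      from orth[OF this] have "(\<integral>x. (if x \<in> \<Omega> then d x * (p x * \<eta> x) else 0) \<partial>lebesgue) = 0"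
        using \<Omega> by (subst Lebesgue_Measure.integral_restrict_UNIV) auto
      moreover have "(\<lambda>x. if x \<in> \<Omega> then d x * (p x * \<eta> x) else 0) = (\<lambda>x. p x * h x)"
        by (auto simp: h_def)
      ultimately show ?thesis by simp
    qed
    have cont_int: "integrable lebesgue (\<lambda>x. f x * h x)" if f: "continuous_on UNIV f" for f
    proof -
      have "compact (f ` cball c \<rho>)"
        by (intro compact_continuous_image continuous_on_subset[OF f]) auto
      then obtain M where M: "\<And>y. y \<in> f ` cball c \<rho> \<Longrightarrow> norm y \<le> M"
        using compact_imp_bounded bounded_iff by metis
      show ?thesis
      proof (rule Bochner_Integration.integrable_bound)
        show "integrable lebesgue (\<lambda>x. M * h x)" using h by simp
        show "(\<lambda>x. f x * h x) \<in> borel_measurable lebesgue"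
          using continuous_imp_lebesgue_measurable[OF f] h by (intro borel_measurable_times) auto
        have "norm (f x * h x) \<le> norm (M * h x)" for x
        proof (cases "x \<in> cball c \<rho>")
          case True
          then have "\<bar>f x\<bar> \<le> \<bar>M\<bar>" using M[of "f x"] by auto
          then show ?thesis by (simp add: abs_mult mult_right_mono)
        qed (use \<eta>0 in \<open>simp add: h_def\<close>)
        then show "AE x in lebesgue. norm (f x * h x) \<le> norm (M * h x)" by simp
      qed
    qed
    have "negligible {x. h x \<noteq> 0}"
    proof (rule orthogonal_to_continuous_imp_negligible[OF h])
      fix f :: "'a \<Rightarrow> real" assume f: "continuous_on UNIV f"
      have "\<bar>\<integral>x. f x * h x \<partial>lebesgue\<bar> \<le> e * (\<integral>x. \<bar>h x\<bar> \<partial>lebesgue)" if e: "e > 0" for e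
      proof -
        obtain p where p: "real_polynomial_function p" "\<And>x. x \<in> cball c \<rho> \<Longrightarrow> \<bar>f x - p x\<bar> < e"
          using Stone_Weierstrass_real_polynomial_function[of "cball c \<rho>" f e] e
            continuous_on_subset[OF f] by auto
        have cp: "continuous_on UNIV p"
          using real_polynomial_function_C1[OF p(1)] by (auto intro: GDERIV_continuous_on)
        have "(\<integral>x. f x * h x \<partial>lebesgue) = (\<integral>x. f x * h x - p x * h x \<partial>lebesgue)"
          using poly[OF p(1)] cont_int[OF f] cont_int[OF cp] by simp
        also have "\<bar>\<dots>\<bar> \<le> (\<integral>x. e * \<bar>h x\<bar> \<partial>lebesgue)"
        proof (rule integral_abs_bound[THEN order_trans], rule integral_mono)
          show "integrable lebesgue (\<lambda>x. \<bar>f x * h x - p x * h x\<bar>)"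
            using cont_int[OF f] cont_int[OF cp] by simp
          show "integrable lebesgue (\<lambda>x. e * \<bar>h x\<bar>)" using h by simp
          show "\<bar>f x * h x - p x * h x\<bar> \<le> e * \<bar>h x\<bar>" for x
          proof (cases "x \<in> cball c \<rho>")
            case True
            then show ?thesis using p(2)[OF True]
              by (simp flip: left_diff_distrib add: abs_mult mult_right_mono)
          qed (use \<eta>0 in \<open>simp add: h_def\<close>)
        qed
        finally show ?thesis by simp
      qed
      then have "\<bar>\<integral>x. f x * h x \<partial>lebesgue\<bar> \<le> 0 * (\<integral>x. \<bar>h x\<bar> \<partial>lebesgue)"
        by (intro tendsto_lowerbound[of "\<lambda>e. e * (\<integral>x. \<bar>h x\<bar> \<partial>lebesgue)" _ "at_right 0"] tendsto_intros)
          (auto simp: eventually_at_right_less intro!: eventually_at_rightI[of 0 1])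
      then show "(\<integral>x. f x * h x \<partial>lebesgue) = 0" by simp
    qed
    moreover have "N \<inter> ball c \<rho> \<subseteq> {x. h x \<noteq> 0}"
    proof
      fix x assume x: "x \<in> N \<inter> ball c \<rho>"
      then have "(norm (x - c))\<^sup>2 < \<rho>\<^sup>2"
        using \<rho> by (intro power_strict_mono) (auto simp: dist_norm norm_minus_commute)
      then show "x \<in> {x. h x \<noteq> 0}" using x by (auto simp: h_def N_def \<eta>_def)
    qed
    ultimately have "negligible (N \<inter> ball c \<rho>)" by (rule negligible_subset)
    then show ?thesis using c \<rho>
      by (intro exI[of _ "N \<inter> ball c \<rho>"]) (auto simp: openin_open)
  qed
  then have "negligible N" by (subst locally_negligible_alt) blast
  then have "N \<in> null_sets lebesgue" by (simp add: negligible_iff_null_sets)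
  then have "AE x in lebesgue. x \<notin> N" by (rule AE_not_in)
  then have "AE x in lebesgue. x \<in> \<Omega> \<longrightarrow> d x = 0" by eventually_elim (auto simp: N_def)
  then show ?thesis using \<Omega> by (subst AE_restrict_space_iff) auto
qed

lemma has_weak_gradient_unique:
  assumes \<Omega>: "open \<Omega>" and g: "has_weak_gradient \<Omega> u g" and g': "has_weak_gradient \<Omega> u g'"
  shows "AE x in lebesgue_on \<Omega>. g x = g' x"
proof -
  have L: "g \<in> Lp_loc 1 \<Omega>" "g' \<in> Lp_loc 1 \<Omega>" using g g' unfolding has_weak_gradient_def by auto
  then have [measurable]: "g \<in> borel_measurable (lebesgue_on \<Omega>)" "g' \<in> borel_measurable (lebesgue_on \<Omega>)"
    by (auto simp: Lp_loc_def)
  have "AE x in lebesgue_on \<Omega>. (g x - g' x) \<bullet> i = 0" if i: "i \<in> Basis" for i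
  proof (rule fundamental_lemma_calculus_of_variations[OF \<Omega>])
    have "integrable (lebesgue_on K) (\<lambda>x. (g x - g' x) \<bullet> i)" if "compact K" "K \<subseteq> \<Omega>" for K
      using Lp_loc_1_integrable[OF L(1) that] Lp_loc_1_integrable[OF L(2) that]
      by (intro integrable_inner_left) auto
    then show "(\<lambda>x. (g x - g' x) \<bullet> i) \<in> Lp_loc 1 \<Omega>"
      unfolding Lp_loc_def by simp
    fix \<phi> assume \<phi>: "\<phi> \<in> C1c \<Omega>"
    obtain K where K: "compact K" "K \<subseteq> \<Omega>" "\<And>x. x \<notin> K \<Longrightarrow> \<phi> x = 0"
      using C1c_support[OF \<phi>] by auto
    note c = C1c_continuous(1)[OF \<phi>]
    have int: "integrable (lebesgue_on \<Omega>) (\<lambda>x. (f x \<bullet> i) * \<phi> x)" if "f \<in> Lp_loc 1 \<Omega>" for f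
      using integrable_inner_left[OF Lp_loc_1_times_compact_support[OF \<Omega> that c K], of i]
      by (simp add: mult.commute)
    have wg: "(\<integral>x. u x * (gradient \<phi> x \<bullet> i) \<partial>lebesgue_on \<Omega>) = - (\<integral>x. (f x \<bullet> i) * \<phi> x \<partial>lebesgue_on \<Omega>)"
      if "has_weak_gradient \<Omega> u f" for f
      using that \<phi> i unfolding has_weak_gradient_def by simp
    have "(\<integral>x. (g x \<bullet> i) * \<phi> x \<partial>lebesgue_on \<Omega>) = (\<integral>x. (g' x \<bullet> i) * \<phi> x \<partial>lebesgue_on \<Omega>)"
      using wg[OF g] wg[OF g'] by simp
    then show "(\<integral>x. ((g x - g' x) \<bullet> i) * \<phi> x \<partial>lebesgue_on \<Omega>) = 0"
      using int[OF L(1)] int[OF L(2)] by (simp add: inner_diff_left left_diff_distrib)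
  qed
  then have "AE x in lebesgue_on \<Omega>. \<forall>i\<in>Basis. (g x - g' x) \<bullet> i = 0"
    by (intro AE_finite_allI) auto
  then show ?thesis
    by eventually_elim (metis euclidean_all_zero_iff right_minus_eq)
qed

section \<open>Crossing an isolated singularity\<close>

lemma integral_lebesgue_on_support:
  fixes f :: "'a::euclidean_space \<Rightarrow> 'b::euclidean_space"
  assumes "open \<Omega>" "\<And>x. x \<notin> \<Omega> \<Longrightarrow> f x = 0"
  shows "integral\<^sup>L (lebesgue_on \<Omega>) f = integral\<^sup>L lebesgue f"
    and "integrable (lebesgue_on \<Omega>) f \<longleftrightarrow> integrable lebesgue f"
proof -
  have "(\<lambda>x. if x \<in> \<Omega> then f x else 0) = f" using assms(2) by auto
  then show "integral\<^sup>L (lebesgue_on \<Omega>) f = integral\<^sup>L lebesgue f"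
    and "integrable (lebesgue_on \<Omega>) f \<longleftrightarrow> integrable lebesgue f"
    using Lebesgue_Measure.integral_restrict_UNIV[of \<Omega> f]
      Lebesgue_Measure.integrable_restrict_UNIV[of \<Omega> f] assms(1) by auto
qed

lemma lebesgue_distr_uminus:
  "distr lebesgue lebesgue uminus = (lebesgue :: 'a::euclidean_space measure)"
  "uminus \<in> lebesgue \<rightarrow>\<^sub>M (lebesgue :: 'a::euclidean_space measure)"
proof -
  have T: "(\<lambda>x::'a. 0 + (\<Sum>j\<in>Basis. (- 1 * (x \<bullet> j)) *\<^sub>R j)) = uminus"
    by (simp add: sum_negf euclidean_representation fun_eq_iff)
  show "distr lebesgue lebesgue uminus = (lebesgue :: 'a measure)"
    using lebesgue_affine_euclidean[of "\<lambda>_. - 1" "0::'a"] unfolding T by (simp add: density_1)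
  show "uminus \<in> lebesgue \<rightarrow>\<^sub>M (lebesgue :: 'a measure)"
    using lebesgue_affine_measurable[of "\<lambda>_. - 1" "0::'a"] unfolding T by simp
qed

lemma integral_lebesgue_reflect:
  fixes f :: "'a::euclidean_space \<Rightarrow> real"
  assumes f: "integrable lebesgue f"
  shows "integrable lebesgue (\<lambda>x. f (- x))" "(\<integral>x. f (- x) \<partial>lebesgue) = integral\<^sup>L lebesgue f"
proof -
  note m = lebesgue_distr_uminus(2) borel_measurable_integrable[OF f]
  show "(\<integral>x. f (- x) \<partial>lebesgue) = integral\<^sup>L lebesgue f"
    using integral_distr[OF m] by (simp add: lebesgue_distr_uminus(1))
  show "integrable lebesgue (\<lambda>x. f (- x))"
    using integrable_distr_eq[OF m] f by (simp add: lebesgue_distr_uminus(1))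
qed

text \<open>With \<open>p\<close> the square of the positive part, a \<open>C\<^sup>1\<close> function, the quotient of \<open>p(t - 1)\<close> by
  \<open>p(t - 1) + p(2 - t)\<close> is a step that needs no gluing.\<close>

lemma smooth_step:
  obtains \<theta> \<theta>' :: "real \<Rightarrow> real"
  where "\<And>t. (\<theta> has_real_derivative \<theta>' t) (at t)" "continuous_on UNIV \<theta>'"
    "\<And>t. t \<le> 1 \<Longrightarrow> \<theta> t = 0" "\<And>t. 2 \<le> t \<Longrightarrow> \<theta> t = 1" "\<And>t. \<bar>\<theta> t\<bar> \<le> 1"
    "\<And>t. t \<notin> {1..2} \<Longrightarrow> \<theta>' t = 0"
proof -
  define p where "p t = (max 0 t)\<^sup>2" for t :: real
  define p' where "p' t = 2 * max 0 t" for t :: real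
  define \<theta> where "\<theta> t = p (t - 1) / (p (t - 1) + p (2 - t))" for t
  define \<theta>' where "\<theta>' t = (p' (t - 1) * (p (t - 1) + p (2 - t)) - p (t - 1) * (p' (t - 1) - p' (2 - t)))
     / ((p (t - 1) + p (2 - t)) * (p (t - 1) + p (2 - t)))" for t
  have p: "(p has_real_derivative p' t) (at t)" for t
    unfolding p_def p'_def by (rule DERIV_max_0_power2)
  have pos: "p (t - 1) + p (2 - t) > 0" for t
    by (cases "t > 1") (auto simp: p_def add_pos_nonneg add_nonneg_pos)
  have p1: "((\<lambda>t. p (t - 1)) has_real_derivative p' (t - 1)) (at t)" for t
  proof -
    have "((\<lambda>t. t - 1) has_real_derivative 1) (at t)" by (auto intro!: derivative_eq_intros)
    from DERIV_chain2[OF p this] show ?thesis by simp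
  qed
  have p2: "((\<lambda>t. p (2 - t)) has_real_derivative - p' (2 - t)) (at t)" for t
  proof -
    have "((\<lambda>t. 2 - t) has_real_derivative - 1) (at t)" by (auto intro!: derivative_eq_intros)
    from DERIV_chain2[OF p this] show ?thesis by simp
  qed
  have D: "(\<theta> has_real_derivative \<theta>' t) (at t)" for t
    unfolding \<theta>_def \<theta>'_def using DERIV_divide[OF p1 DERIV_add[OF p1 p2], of t] pos[of t] by simp
  show ?thesis
  proof (rule that[of \<theta> \<theta>', OF D])
    have "continuous_on UNIV p'" "continuous_on UNIV p"
      unfolding p_def p'_def by (intro continuous_intros)+
    then show "continuous_on UNIV \<theta>'" unfolding \<theta>'_def p_def p'_def
      using pos by (intro continuous_intros) (auto simp: p_def less_imp_neq[symmetric])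
    show "\<theta> t = 0" if "t \<le> 1" for t using that by (simp add: \<theta>_def p_def)
    show "\<theta> t = 1" if "2 \<le> t" for t using that by (simp add: \<theta>_def p_def)
    have "0 \<le> p t" for t by (simp add: p_def)
    then show "\<bar>\<theta> t\<bar> \<le> 1" for t using pos[of t] by (simp add: \<theta>_def)
    show "\<theta>' t = 0" if "t \<notin> {1..2}" for t using that by (auto simp: \<theta>'_def p_def p'_def)
  qed
qed

text \<open>The cutoffs live at scale \<open>1 / k\<close>, so their gradients are of size \<open>k\<close>, but only where
  \<open>|x|\<close> is comparable to \<open>1 / k\<close>: the bound on \<open>|x| |\<nabla>\<eta>|\<close> is uniform in \<open>k\<close>.\<close>

lemma puncturing_cutoffs:
  obtains \<eta> :: "nat \<Rightarrow> 'a::euclidean_space \<Rightarrow> real" and E :: "nat \<Rightarrow> 'a \<Rightarrow> 'a" and C :: real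
  where "0 \<le> C" "\<And>k x. GDERIV (\<eta> k) x :> E k x" "\<And>k. continuous_on UNIV (E k)"
    "\<And>k x. \<bar>\<eta> k x\<bar> \<le> 1" "\<And>k x. norm x \<le> 1 / Suc k \<Longrightarrow> \<eta> k x = 0"
    "\<And>k x. norm x * norm (E k x) \<le> C" "\<And>k x. E k (- x) = - E k x"
    "\<And>x. x \<noteq> 0 \<Longrightarrow> \<forall>\<^sub>F k in sequentially. \<eta> k x = 1 \<and> E k x = 0"
proof -
  obtain \<theta> \<theta>' :: "real \<Rightarrow> real" where D: "\<And>t. (\<theta> has_real_derivative \<theta>' t) (at t)"
    and cont: "continuous_on UNIV \<theta>'" and step: "\<And>t. t \<le> 1 \<Longrightarrow> \<theta> t = 0" "\<And>t. 2 \<le> t \<Longrightarrow> \<theta> t = 1"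
      "\<And>t. \<bar>\<theta> t\<bar> \<le> 1" and supp: "\<And>t. t \<notin> {1..2} \<Longrightarrow> \<theta>' t = 0"
    by (rule smooth_step) blast
  obtain M where M: "0 \<le> M" "\<And>t. norm (\<theta>' t) \<le> M"
    by (rule compact_support_bounded[OF cont _ supp]) auto
  define \<eta> where "\<eta> k x = \<theta> ((Suc k)\<^sup>2 * (norm x)\<^sup>2)" for k and x :: 'a
  define E where "E k x = \<theta>' ((Suc k)\<^sup>2 * (norm x)\<^sup>2) *\<^sub>R ((Suc k)\<^sup>2 *\<^sub>R 2 *\<^sub>R x)" for k and x :: 'a
  show ?thesis
  proof (rule that[of "4 * M" \<eta> E])
    show "0 \<le> 4 * M" using M by simp
    show "GDERIV (\<eta> k) x :> E k x" for k x
      unfolding \<eta>_def E_def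
      by (rule GDERIV_DERIV_compose[OF _ D])
        (use GDERIV_mult[OF GDERIV_const[of "real ((Suc k)\<^sup>2)"] GDERIV_norm_power2, of x] in simp)
    show "continuous_on UNIV (E k)" for k
      unfolding E_def by (intro continuous_intros continuous_on_compose2[OF cont]) auto
    show "\<bar>\<eta> k x\<bar> \<le> 1" for k x unfolding \<eta>_def by (rule step)
    show "\<eta> k x = 0" if "norm x \<le> 1 / Suc k" for k x
    proof -
      have "(Suc k * norm x)\<^sup>2 \<le> 1\<^sup>2"
        using that by (intro power_mono) (auto simp: field_simps)
      then show ?thesis unfolding \<eta>_def by (intro step) (simp add: power_mult_distrib)
    qed
    show "norm x * norm (E k x) \<le> 4 * M" for k x
    proof -
      define t where "t = (Suc k)\<^sup>2 * (norm x)\<^sup>2"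
      have t: "0 \<le> t" by (simp add: t_def)
      have "norm x * norm (E k x) = norm x * (\<bar>\<theta>' t\<bar> * ((Suc k)\<^sup>2 * (2 * norm x)))"
        unfolding E_def t_def[symmetric] by (simp del: of_nat_Suc add: abs_mult)
      also have "\<dots> = 2 * (t * \<bar>\<theta>' t\<bar>)"
        unfolding t_def by (simp add: power2_eq_square mult_ac del: of_nat_Suc)
      also have "\<dots> \<le> 2 * (2 * M)"
      proof (cases "t \<in> {1..2}")
        case True
        then show ?thesis using M(2)[of t] by (intro mult_left_mono mult_mono) auto
      qed (use supp M in auto)
      finally show ?thesis by simp
    qed
    show "E k (- x) = - E k x" for k x by (simp add: E_def)
    show "\<forall>\<^sub>F k in sequentially. \<eta> k x = 1 \<and> E k x = 0" if "x \<noteq> 0" for x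
      using eventually_ge_at_top[of "nat \<lceil>2 / norm x\<rceil>"]
    proof eventually_elim
      case (elim k)
      then have "2 / norm x \<le> Suc k" by linarith
      then have "2 \<le> Suc k * norm x" using that by (simp add: field_simps)
      then have "2\<^sup>2 \<le> (Suc k * norm x)\<^sup>2" by (intro power_mono) auto
      then have "4 \<le> (Suc k)\<^sup>2 * (norm x)\<^sup>2" by (simp add: power_mult_distrib)
      then show ?case using step(2)[of "(Suc k)\<^sup>2 * (norm x)\<^sup>2"] supp[of "(Suc k)\<^sup>2 * (norm x)\<^sup>2"]
        by (simp add: \<eta>_def E_def)
    qed
  qed
qed

lemma C1c_times_puncturing_cutoff:
  fixes \<phi> :: "'a::euclidean_space \<Rightarrow> real"
  assumes \<phi>: "\<phi> \<in> C1c \<Omega>" and \<eta>: "\<And>x. GDERIV \<eta> x :> E x" "continuous_on UNIV E"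
    and e: "0 < e" "\<And>x. norm x \<le> e \<Longrightarrow> \<eta> x = 0"
  shows "(\<lambda>x. \<eta> x * \<phi> x) \<in> C1c (\<Omega> - {0})"
    and "gradient (\<lambda>x. \<eta> x * \<phi> x) x = \<eta> x *\<^sub>R gradient \<phi> x + \<phi> x *\<^sub>R E x"
proof -
  obtain K where K: "compact K" "K \<subseteq> \<Omega>" and \<phi>0: "\<And>x. x \<notin> K \<Longrightarrow> \<phi> x = 0"
    using C1c_support[OF \<phi>] by auto
  have D: "GDERIV (\<lambda>x. \<eta> x * \<phi> x) x :> \<eta> x *\<^sub>R gradient \<phi> x + \<phi> x *\<^sub>R E x" for x
    by (rule GDERIV_mult[OF \<eta>(1) C1c_GDERIV[OF \<phi>]])
  then show "gradient (\<lambda>x. \<eta> x * \<phi> x) x = \<eta> x *\<^sub>R gradient \<phi> x + \<phi> x *\<^sub>R E x"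
    by (rule gradient_eqI)
  show "(\<lambda>x. \<eta> x * \<phi> x) \<in> C1c (\<Omega> - {0})"
  proof (rule C1cI[OF D])
    have "continuous_on UNIV \<eta>" using \<eta>(1) by (rule GDERIV_continuous_on)
    then show "continuous_on UNIV (\<lambda>x. \<eta> x *\<^sub>R gradient \<phi> x + \<phi> x *\<^sub>R E x)"
      using C1c_continuous[OF \<phi>] \<eta>(2) by (intro continuous_intros)
    have "closed {x::'a. e \<le> norm x}" by (intro closed_Collect_le continuous_intros)
    then show "compact (K \<inter> {x. e \<le> norm x})" using K(1) by (rule compact_Int_closed[rotated])
    show "K \<inter> {x. e \<le> norm x} \<subseteq> \<Omega> - {0}" using K(2) e(1) by auto
    show "\<eta> x * \<phi> x = 0" if "x \<notin> K \<inter> {x. e \<le> norm x}" for x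
      using that e(2)[of x] \<phi>0[of x] by auto
  qed
qed

lemma AE_lebesgue_neq_0: "AE x in lebesgue. x \<noteq> (0::'a::euclidean_space)"
  by (rule AE_not_in[of "{0}", simplified]) (simp add: null_sets_completionI)

text \<open>In the identity obtained by testing with \<open>\<eta> \<phi>\<close> the error term \<open>w \<phi> \<nabla>\<eta>\<close> is at most a constant
  times \<open>|w \<phi>| / |x|\<close>, so it tends to zero by dominated convergence.\<close>

lemma integration_by_parts_across_0:
  fixes w :: "'a::euclidean_space \<Rightarrow> real"
  assumes \<Omega>: "open \<Omega>" and W: "\<And>x. x \<in> \<Omega> - {0} \<Longrightarrow> GDERIV w x :> W x"
    and cont: "continuous_on (\<Omega> - {0}) W"
    and L: "w \<in> Lp_loc 1 \<Omega>" "W \<in> Lp_loc 1 \<Omega>" "(\<lambda>x. w x / norm x) \<in> Lp_loc 1 \<Omega>"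
    and \<phi>: "\<phi> \<in> C1c \<Omega>"
  shows "(\<integral>x. w x * (gradient \<phi> x \<bullet> v) \<partial>lebesgue_on \<Omega>) = - (\<integral>x. (W x \<bullet> v) * \<phi> x \<partial>lebesgue_on \<Omega>)"
proof -
  obtain K where K: "compact K" "K \<subseteq> \<Omega>" and \<phi>0: "\<And>x. x \<notin> K \<Longrightarrow> \<phi> x = 0"
    and g0: "\<And>x. x \<notin> K \<Longrightarrow> gradient \<phi> x = 0"
    using C1c_support[OF \<phi>] by auto
  have \<Omega>0: "\<phi> x = 0" "gradient \<phi> x = 0" if "x \<notin> \<Omega>" for x
    using that K(2) \<phi>0[of x] g0[of x] by blast+
  note c = C1c_continuous[OF \<phi>]
  obtain \<eta> :: "nat \<Rightarrow> 'a \<Rightarrow> real" and E :: "nat \<Rightarrow> 'a \<Rightarrow> 'a" and C :: real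
    where C: "0 \<le> C" and \<eta>: "\<And>k x. GDERIV (\<eta> k) x :> E k x" "\<And>k. continuous_on UNIV (E k)"
    and \<eta>1: "\<And>k x. \<bar>\<eta> k x\<bar> \<le> 1" and near: "\<And>k x. norm x \<le> 1 / Suc k \<Longrightarrow> \<eta> k x = 0"
    and E: "\<And>k x. norm x * norm (E k x) \<le> C" "\<And>k x. E k (- x) = - E k x"
    and ev: "\<And>x. x \<noteq> 0 \<Longrightarrow> \<forall>\<^sub>F k in sequentially. \<eta> k x = 1 \<and> E k x = 0"
    by (rule puncturing_cutoffs) blast
  define \<psi> where "\<psi> k x = \<eta> k x * \<phi> x" for k x
  have \<psi>: "\<psi> k \<in> C1c (\<Omega> - {0})" and g: "gradient (\<psi> k) x = \<eta> k x *\<^sub>R gradient \<phi> x + \<phi> x *\<^sub>R E k x" for k x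
    unfolding \<psi>_def
    using C1c_times_puncturing_cutoff[OF \<phi> \<eta>, of "1 / Suc k" k] near[of _ k] by simp_all
  have op: "open (\<Omega> - {0})" using \<Omega> by (simp add: open_delete)
  note ibp = C1_integration_by_parts[OF op W cont \<psi>]
  have int1: "integrable lebesgue (\<lambda>x. w x * (gradient \<phi> x \<bullet> v))"
  proof -
    have "integrable (lebesgue_on \<Omega>) (\<lambda>x. (gradient \<phi> x \<bullet> v) *\<^sub>R w x)"
      by (rule Lp_loc_1_times_compact_support[OF \<Omega> L(1) _ K])
        (auto simp: g0 intro!: continuous_on_inner c continuous_on_const)
    then show ?thesis
      by (subst (asm) integral_lebesgue_on_support(2)[OF \<Omega>]) (auto simp: \<Omega>0 mult.commute)
  qed
  have int2: "integrable lebesgue (\<lambda>x. (W x \<bullet> v) * \<phi> x)"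
  proof -
    have "integrable (lebesgue_on \<Omega>) (\<lambda>x. (\<phi> x *\<^sub>R W x) \<bullet> v)"
      using Lp_loc_1_times_compact_support[OF \<Omega> L(2) c(1) K \<phi>0] by (rule integrable_inner_left)
    then show ?thesis
      by (subst (asm) integral_lebesgue_on_support(2)[OF \<Omega>]) (auto simp: \<Omega>0 mult.commute)
  qed
  have int3: "integrable lebesgue (\<lambda>x. \<phi> x * (w x / norm x))"
  proof -
    have "integrable (lebesgue_on \<Omega>) (\<lambda>x. \<phi> x *\<^sub>R (w x / norm x))"
      using \<phi>0 by (rule Lp_loc_1_times_compact_support[OF \<Omega> L(3) c(1) K])
    then show ?thesis
      by (subst (asm) integral_lebesgue_on_support(2)[OF \<Omega>]) (auto simp: \<Omega>0)
  qed
  have "(\<lambda>k. \<integral>x. w x * (gradient (\<psi> k) x \<bullet> v) \<partial>lebesgue) \<longlonglongrightarrow> (\<integral>x. w x * (gradient \<phi> x \<bullet> v) \<partial>lebesgue)"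
  proof (rule integral_dominated_convergence[where w = "\<lambda>x. \<bar>w x * (gradient \<phi> x \<bullet> v)\<bar>
        + (C * norm v) * \<bar>\<phi> x * (w x / norm x)\<bar>"])
    show "integrable lebesgue (\<lambda>x. \<bar>w x * (gradient \<phi> x \<bullet> v)\<bar> + (C * norm v) * \<bar>\<phi> x * (w x / norm x)\<bar>)"
      using int1 int3 by (intro Bochner_Integration.integrable_add integrable_mult_right integrable_abs)
    show "AE x in lebesgue. norm (w x * (gradient (\<psi> k) x \<bullet> v))
        \<le> \<bar>w x * (gradient \<phi> x \<bullet> v)\<bar> + (C * norm v) * \<bar>\<phi> x * (w x / norm x)\<bar>" for k
      using AE_lebesgue_neq_0
    proof eventually_elim
      case (elim x)
      have "norm (E k x) \<le> C / norm x" using E(1)[of x k] elim by (simp add: field_simps)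
      then have "\<bar>E k x \<bullet> v\<bar> \<le> C / norm x * norm v"
        by (intro order_trans[OF Cauchy_Schwarz_ineq2] mult_right_mono) auto
      then have "\<bar>w x * \<phi> x\<bar> * \<bar>E k x \<bullet> v\<bar> \<le> \<bar>w x * \<phi> x\<bar> * (C / norm x * norm v)"
        by (intro mult_left_mono) auto
      then have 2: "\<bar>w x * (\<phi> x * (E k x \<bullet> v))\<bar> \<le> (C * norm v) * \<bar>\<phi> x * (w x / norm x)\<bar>"
        by (simp add: abs_mult abs_divide mult_ac)
      have "\<bar>w x * (\<eta> k x * (gradient \<phi> x \<bullet> v))\<bar> = \<bar>\<eta> k x\<bar> * \<bar>w x * (gradient \<phi> x \<bullet> v)\<bar>"
        by (simp add: abs_mult)
      also have "\<dots> \<le> \<bar>w x * (gradient \<phi> x \<bullet> v)\<bar>" using \<eta>1 by (intro mult_left_le_one_le) auto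
      finally have 1: "\<bar>w x * (\<eta> k x * (gradient \<phi> x \<bullet> v))\<bar> \<le> \<bar>w x * (gradient \<phi> x \<bullet> v)\<bar>" .
      show ?case using 1 2 unfolding g inner_add_left inner_scaleR_left distrib_left real_norm_def
        by linarith
    qed
    show "AE x in lebesgue. (\<lambda>k. w x * (gradient (\<psi> k) x \<bullet> v)) \<longlonglongrightarrow> w x * (gradient \<phi> x \<bullet> v)"
      using AE_lebesgue_neq_0
    proof eventually_elim
      case (elim x)
      show ?case
        by (rule tendsto_eventually) (use ev[OF elim] in eventually_elim, simp add: g)
    qed
  qed (use int1 ibp(1) in auto)
  moreover have "(\<lambda>k. \<integral>x. (W x \<bullet> v) * \<psi> k x \<partial>lebesgue) \<longlonglongrightarrow> (\<integral>x. (W x \<bullet> v) * \<phi> x \<partial>lebesgue)"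
  proof (rule integral_dominated_convergence[where w = "\<lambda>x. \<bar>(W x \<bullet> v) * \<phi> x\<bar>"])
    show "AE x in lebesgue. norm ((W x \<bullet> v) * \<psi> k x) \<le> \<bar>(W x \<bullet> v) * \<phi> x\<bar>" for k
    proof (intro always_eventually allI)
      fix x
      have "norm ((W x \<bullet> v) * \<psi> k x) = \<bar>\<eta> k x\<bar> * \<bar>(W x \<bullet> v) * \<phi> x\<bar>" by (simp add: \<psi>_def abs_mult)
      also have "\<dots> \<le> \<bar>(W x \<bullet> v) * \<phi> x\<bar>" using \<eta>1 by (intro mult_left_le_one_le) auto
      finally show "norm ((W x \<bullet> v) * \<psi> k x) \<le> \<bar>(W x \<bullet> v) * \<phi> x\<bar>" .
    qed
    show "AE x in lebesgue. (\<lambda>k. (W x \<bullet> v) * \<psi> k x) \<longlonglongrightarrow> (W x \<bullet> v) * \<phi> x"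
      using AE_lebesgue_neq_0
    proof eventually_elim
      case (elim x)
      show ?case
        by (rule tendsto_eventually) (use ev[OF elim] in eventually_elim, simp add: \<psi>_def)
    qed
  qed (use int2 ibp(2) in auto)
  then have lim: "(\<lambda>k. - (\<integral>x. (W x \<bullet> v) * \<psi> k x \<partial>lebesgue)) \<longlonglongrightarrow> - (\<integral>x. (W x \<bullet> v) * \<phi> x \<partial>lebesgue)"
    by (rule tendsto_minus)
  have "(\<lambda>k. \<integral>x. w x * (gradient (\<psi> k) x \<bullet> v) \<partial>lebesgue) \<longlonglongrightarrow> - (\<integral>x. (W x \<bullet> v) * \<phi> x \<partial>lebesgue)"
  proof -
    have "(\<integral>x. w x * (gradient (\<psi> k) x \<bullet> v) \<partial>lebesgue) = - (\<integral>x. (W x \<bullet> v) * \<psi> k x \<partial>lebesgue)" for k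
      by (rule ibp(3))
    then show ?thesis using lim by (simp only:)
  qed
  ultimately have eq: "(\<integral>x. w x * (gradient \<phi> x \<bullet> v) \<partial>lebesgue) = - (\<integral>x. (W x \<bullet> v) * \<phi> x \<partial>lebesgue)"
    by (rule LIMSEQ_unique)
  have "(\<integral>x. w x * (gradient \<phi> x \<bullet> v) \<partial>lebesgue_on \<Omega>) = (\<integral>x. w x * (gradient \<phi> x \<bullet> v) \<partial>lebesgue)"
    by (rule integral_lebesgue_on_support(1)[OF \<Omega>]) (auto simp: \<Omega>0)
  moreover have "(\<integral>x. (W x \<bullet> v) * \<phi> x \<partial>lebesgue_on \<Omega>) = (\<integral>x. (W x \<bullet> v) * \<phi> x \<partial>lebesgue)"
    by (rule integral_lebesgue_on_support(1)[OF \<Omega>]) (auto simp: \<Omega>0)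
  ultimately show ?thesis using eq by simp
qed

text \<open>Testing with \<open>\<eta> \<phi>\<close> leaves the error term \<open>\<phi> V \<bullet> \<nabla>\<eta>\<close>. It is bounded by \<open>|V| / |x|\<close>, which may fail to be
  integrable. But as \<open>V\<close> is even and \<open>\<nabla>\<eta>\<close> is odd, only the odd part of \<open>\<phi>\<close> contributes to its
  integral; that part is \<open>O(|x|)\<close> and compensates for \<open>|\<nabla>\<eta>|\<close>.\<close>

lemma even_divergence_free_across_0:
  fixes V :: "'a::euclidean_space \<Rightarrow> 'a"
  assumes \<Omega>: "open \<Omega>" "\<And>x. x \<in> \<Omega> \<Longrightarrow> - x \<in> \<Omega>"
    and even: "\<And>x. V (- x) = V x"
    and J: "\<And>i x. i \<in> Basis \<Longrightarrow> x \<in> \<Omega> - {0} \<Longrightarrow> GDERIV (\<lambda>x. V x \<bullet> i) x :> J i x"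
    and cont: "\<And>i. i \<in> Basis \<Longrightarrow> continuous_on (\<Omega> - {0}) (J i)"
    and div: "\<And>x. x \<in> \<Omega> - {0} \<Longrightarrow> (\<Sum>i\<in>Basis. J i x \<bullet> i) = 0"
    and L: "V \<in> Lp_loc 1 \<Omega>" and \<phi>: "\<phi> \<in> C1c \<Omega>"
  shows "(\<integral>x. V x \<bullet> gradient \<phi> x \<partial>lebesgue_on \<Omega>) = 0"
proof -
  obtain K where K: "compact K" "K \<subseteq> \<Omega>" and \<phi>0: "\<And>x. x \<notin> K \<Longrightarrow> \<phi> x = 0"
    and g0: "\<And>x. x \<notin> K \<Longrightarrow> gradient \<phi> x = 0"
    using C1c_support[OF \<phi>] by auto
  have \<Omega>0: "\<phi> x = 0" "gradient \<phi> x = 0" if "x \<notin> \<Omega>" for x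
    using that K(2) \<phi>0[of x] g0[of x] by blast+
  note c = C1c_continuous[OF \<phi>]
  obtain M where M: "0 \<le> M" "\<And>x. norm (gradient \<phi> x) \<le> M"
    by (rule compact_support_bounded[OF c(2) K(1) g0]) auto
  have odd_part: "\<bar>\<phi> x - \<phi> (- x)\<bar> \<le> 2 * M * norm x" for x
  proof -
    have "norm (\<phi> x - \<phi> (- x)) \<le> M * norm (x - (- x))"
    proof (rule differentiable_bound[of UNIV \<phi> "\<lambda>x h. h \<bullet> gradient \<phi> x"])
      show "(\<phi> has_derivative (\<lambda>h. h \<bullet> gradient \<phi> x)) (at x within UNIV)" for x
        using C1c_GDERIV[OF \<phi>, of x] by (simp add: gderiv_def)
      show "onorm (\<lambda>h. h \<bullet> gradient \<phi> x) \<le> M" for x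
      proof (rule onorm_bound[OF M(1)])
        show "norm (h \<bullet> gradient \<phi> x) \<le> M * norm h" for h
          using Cauchy_Schwarz_ineq2[of h "gradient \<phi> x"] mult_left_mono[OF M(2)[of x], of "norm h"]
          by (simp add: mult.commute)
      qed
    qed auto
    moreover have "x - (- x) = 2 *\<^sub>R x" by (simp add: scaleR_2)
    ultimately show ?thesis by simp
  qed
  obtain \<eta> :: "nat \<Rightarrow> 'a \<Rightarrow> real" and E :: "nat \<Rightarrow> 'a \<Rightarrow> 'a" and C :: real
    where C: "0 \<le> C" and \<eta>: "\<And>k x. GDERIV (\<eta> k) x :> E k x" "\<And>k. continuous_on UNIV (E k)"
    and \<eta>1: "\<And>k x. \<bar>\<eta> k x\<bar> \<le> 1" and near: "\<And>k x. norm x \<le> 1 / Suc k \<Longrightarrow> \<eta> k x = 0"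
    and E: "\<And>k x. norm x * norm (E k x) \<le> C" "\<And>k x. E k (- x) = - E k x"
    and ev: "\<And>x. x \<noteq> 0 \<Longrightarrow> \<forall>\<^sub>F k in sequentially. \<eta> k x = 1 \<and> E k x = 0"
    by (rule puncturing_cutoffs) blast
  define \<psi> where "\<psi> k x = \<eta> k x * \<phi> x" for k x
  have \<psi>: "\<psi> k \<in> C1c (\<Omega> - {0})" and g: "gradient (\<psi> k) x = \<eta> k x *\<^sub>R gradient \<phi> x + \<phi> x *\<^sub>R E k x" for k x
    unfolding \<psi>_def
    using C1c_times_puncturing_cutoff[OF \<phi> \<eta>, of "1 / Suc k" k] near[of _ k] by simp_all
  have op: "open (\<Omega> - {0})" using \<Omega> by (simp add: open_delete)
  note ibp = C1_integration_by_parts[OF op J cont \<psi>]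
  have Vg: "V x \<bullet> gradient (\<psi> k) x = (\<Sum>i\<in>Basis. (V x \<bullet> i) * (gradient (\<psi> k) x \<bullet> i))" for k x
    by (rule euclidean_inner)
  have int\<psi>: "integrable lebesgue (\<lambda>x. V x \<bullet> gradient (\<psi> k) x)" for k
    unfolding Vg by (intro Bochner_Integration.integrable_sum ibp(1))
  have zero: "(\<integral>x. V x \<bullet> gradient (\<psi> k) x \<partial>lebesgue) = 0" for k
  proof -
    have "(\<integral>x. V x \<bullet> gradient (\<psi> k) x \<partial>lebesgue)
        = (\<Sum>i\<in>Basis. \<integral>x. (V x \<bullet> i) * (gradient (\<psi> k) x \<bullet> i) \<partial>lebesgue)"
      unfolding Vg by (intro Bochner_Integration.integral_sum ibp(1))
    also have "\<dots> = - (\<Sum>i\<in>Basis. \<integral>x. (J i x \<bullet> i) * \<psi> k x \<partial>lebesgue)"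
      unfolding sum_negf[symmetric] by (intro sum.cong refl ibp(3))
    also have "(\<Sum>i\<in>Basis. \<integral>x. (J i x \<bullet> i) * \<psi> k x \<partial>lebesgue)
        = (\<integral>x. (\<Sum>i\<in>Basis. (J i x \<bullet> i) * \<psi> k x) \<partial>lebesgue)"
      by (intro Bochner_Integration.integral_sum[symmetric] ibp(2))
    also have "(\<lambda>x. \<Sum>i\<in>Basis. (J i x \<bullet> i) * \<psi> k x) = (\<lambda>x. 0)"
    proof
      fix x
      have "\<psi> k x = 0" if "x \<notin> \<Omega> - {0}"
        using that K(2) \<phi>0[of x] near[of x k] by (auto simp: \<psi>_def)
      then show "(\<Sum>i\<in>Basis. (J i x \<bullet> i) * \<psi> k x) = 0"
        using div[of x] by (cases "x \<in> \<Omega> - {0}") (auto simp flip: sum_distrib_right)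
    qed
    finally show ?thesis by simp
  qed
  have int\<phi>: "integrable lebesgue (\<lambda>x. V x \<bullet> gradient \<phi> x)"
  proof -
    have "integrable (lebesgue_on \<Omega>) (\<lambda>x. ((gradient \<phi> x \<bullet> i) *\<^sub>R V x) \<bullet> i)" for i
      by (intro integrable_inner_left Lp_loc_1_times_compact_support[OF \<Omega>(1) L _ K]
          continuous_on_inner[OF c(2) continuous_on_const]) (simp add: g0)
    then have "integrable (lebesgue_on \<Omega>) (\<lambda>x. \<Sum>i\<in>Basis. (V x \<bullet> i) * (gradient \<phi> x \<bullet> i))"
      by (intro Bochner_Integration.integrable_sum) (simp add: mult.commute)
    then have "integrable (lebesgue_on \<Omega>) (\<lambda>x. V x \<bullet> gradient \<phi> x)"
      unfolding euclidean_inner[of "V _" "gradient \<phi> _"] .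
    then show ?thesis
      by (subst (asm) integral_lebesgue_on_support(2)[OF \<Omega>(1)]) (auto simp: \<Omega>0)
  qed
  have int\<eta>: "integrable lebesgue (\<lambda>x. \<eta> k x * (V x \<bullet> gradient \<phi> x))" for k
  proof (rule Bochner_Integration.integrable_bound[OF int\<phi>])
    have "continuous_on UNIV (\<eta> k)" using \<eta>(1) by (rule GDERIV_continuous_on)
    then show "(\<lambda>x. \<eta> k x * (V x \<bullet> gradient \<phi> x)) \<in> borel_measurable lebesgue"
      using int\<phi> by (intro borel_measurable_times continuous_imp_lebesgue_measurable[of "\<eta> k"]) auto
    show "AE x in lebesgue. norm (\<eta> k x * (V x \<bullet> gradient \<phi> x)) \<le> norm (V x \<bullet> gradient \<phi> x)"
      using \<eta>1 by (intro always_eventually allI) (simp add: abs_mult mult_left_le_one_le)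
  qed
  define a where "a k x = \<phi> x * (V x \<bullet> E k x)" for k x
  have split: "V x \<bullet> gradient (\<psi> k) x = \<eta> k x * (V x \<bullet> gradient \<phi> x) + a k x" for k x
    by (simp add: g a_def inner_add_right)
  have inta: "integrable lebesgue (a k)" for k
  proof -
    have "a k = (\<lambda>x. V x \<bullet> gradient (\<psi> k) x - \<eta> k x * (V x \<bullet> gradient \<phi> x))"
      unfolding split by simp
    then show ?thesis using int\<psi> int\<eta> by simp
  qed
  \<comment> \<open>The error term is replaced by its even part, which has the same integral.\<close>
  define q where "q k x = \<eta> k x * (V x \<bullet> gradient \<phi> x) + (a k x + a k (- x)) / 2" for k x
  have q0: "integral\<^sup>L lebesgue (q k) = 0" for k
    using zero[of k] int\<eta>[of k] inta[of k] integral_lebesgue_reflect[OF inta[of k]]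
    unfolding split q_def by simp
  have intq: "integrable lebesgue (q k)" for k
    using int\<eta>[of k] inta[of k] integral_lebesgue_reflect[OF inta[of k]] unfolding q_def by simp
  define K' where "K' = K \<union> uminus ` K"
  have K': "compact K'" "K' \<subseteq> \<Omega>"
    using K \<Omega>(2) by (auto simp: K'_def intro!: compact_Un compact_continuous_image continuous_intros)
  have intV: "integrable lebesgue (\<lambda>x. if x \<in> K' then norm (V x) else 0)"
    using integrable_norm[OF Lp_loc_1_integrable[OF L K']] K'(1)
    by (subst Lebesgue_Measure.integrable_restrict_UNIV) (auto simp: compact_imp_closed)
  have a_sum: "a k x + a k (- x) = (\<phi> x - \<phi> (- x)) * (V x \<bullet> E k x)" for k x
    by (simp add: a_def even E(2) algebra_simps)
  have a_bound: "\<bar>(a k x + a k (- x)) / 2\<bar> \<le> M * C * (if x \<in> K' then norm (V x) else 0)" for k x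
  proof (cases "x \<in> K'")
    case True
    have "\<bar>V x \<bullet> E k x\<bar> \<le> norm (V x) * norm (E k x)" by (rule Cauchy_Schwarz_ineq2)
    then have "\<bar>a k x + a k (- x)\<bar> \<le> (2 * M * norm x) * (norm (V x) * norm (E k x))"
      unfolding a_sum abs_mult using odd_part M(1) by (intro mult_mono) auto
    also have "\<dots> = 2 * M * norm (V x) * (norm x * norm (E k x))" by (simp add: mult_ac)
    also have "\<dots> \<le> 2 * M * norm (V x) * C" using E(1) M(1) by (intro mult_left_mono) auto
    finally show ?thesis using True by (simp add: mult_ac)
  next
    case False
    then have "x \<notin> K" "- x \<notin> K" unfolding K'_def by (auto simp: image_iff)
    then show ?thesis using False by (simp add: a_def \<phi>0)
  qed
  have "(\<lambda>k. integral\<^sup>L lebesgue (q k)) \<longlonglongrightarrow> (\<integral>x. V x \<bullet> gradient \<phi> x \<partial>lebesgue)"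
  proof (rule integral_dominated_convergence[where w = "\<lambda>x. \<bar>V x \<bullet> gradient \<phi> x\<bar>
        + M * C * (if x \<in> K' then norm (V x) else 0)"])
    show "integrable lebesgue (\<lambda>x. \<bar>V x \<bullet> gradient \<phi> x\<bar> + M * C * (if x \<in> K' then norm (V x) else 0))"
      using int\<phi> intV by (intro Bochner_Integration.integrable_add integrable_mult_right integrable_abs)
    show "AE x in lebesgue. norm (q k x)
        \<le> \<bar>V x \<bullet> gradient \<phi> x\<bar> + M * C * (if x \<in> K' then norm (V x) else 0)" for k
    proof (intro always_eventually allI)
      fix x
      have "\<bar>\<eta> k x * (V x \<bullet> gradient \<phi> x)\<bar> \<le> \<bar>V x \<bullet> gradient \<phi> x\<bar>"
        unfolding abs_mult using \<eta>1 by (intro mult_left_le_one_le) auto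
      then show "norm (q k x) \<le> \<bar>V x \<bullet> gradient \<phi> x\<bar> + M * C * (if x \<in> K' then norm (V x) else 0)"
        using a_bound[of k x] unfolding q_def real_norm_def by linarith
    qed
    show "AE x in lebesgue. (\<lambda>k. q k x) \<longlonglongrightarrow> V x \<bullet> gradient \<phi> x"
      using AE_lebesgue_neq_0
    proof eventually_elim
      case (elim x)
      show ?case
        by (rule tendsto_eventually) (use ev[OF elim] in eventually_elim, simp add: q_def a_sum)
    qed
  qed (use int\<phi> intq in auto)
  then have "(\<integral>x. V x \<bullet> gradient \<phi> x \<partial>lebesgue) = 0" by (simp add: q0 LIMSEQ_const_iff)
  moreover have "(\<integral>x. V x \<bullet> gradient \<phi> x \<partial>lebesgue_on \<Omega>) = (\<integral>x. V x \<bullet> gradient \<phi> x \<partial>lebesgue)"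
    by (rule integral_lebesgue_on_support(1)[OF \<Omega>(1)]) (auto simp: \<Omega>0)
  ultimately show ?thesis by simp
qed

section \<open>Radial profiles with logarithmic corrections\<close>

text \<open>The value 0 for \<open>s \<le> 0\<close> is the limit at the origin. The constant 24 is chosen for the bounds on
  \<open>tangential_coeff\<close> below, which make the coefficient matrix elliptic on the whole unit ball.\<close>

definition recip_log :: "real \<Rightarrow> real" where
  "recip_log s = (if s \<le> 0 then 0 else 1 / (24 - ln s))"

definition log_power :: "real \<Rightarrow> nat \<Rightarrow> real \<Rightarrow> real" where
  "log_power c k s = s powr c * recip_log s ^ k"

lemma recip_log_bounds:
  assumes "0 < s" "s < 1"
  shows "0 < recip_log s" "recip_log s \<le> 1 / 24"
proof -
  define l where "l = ln s"
  have "l < 0" using assms by (simp add: l_def)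
  then show "0 < recip_log s" "recip_log s \<le> 1 / 24"
    using assms unfolding recip_log_def l_def[symmetric] by (auto simp: field_simps)
qed

lemma recip_log_nonneg: "s < 1 \<Longrightarrow> 0 \<le> recip_log s"
  using recip_log_bounds(1)[of s] by (cases "0 < s") (auto simp: recip_log_def)

lemma DERIV_recip_log:
  assumes "0 < s" "s < 1"
  shows "(recip_log has_real_derivative (recip_log s)\<^sup>2 / s) (at s)"
proof -
  have "ln s \<noteq> 24" using assms ln_less_zero[of s] by linarith
  then have "((\<lambda>s. 1 / (24 - ln s)) has_real_derivative (1 / (24 - ln s))\<^sup>2 / s) (at s)"
    using assms by (auto intro!: derivative_eq_intros simp: power2_eq_square field_simps)
  then have "(recip_log has_real_derivative (1 / (24 - ln s))\<^sup>2 / s) (at s)"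
    by (rule has_field_derivative_transform_within_open[of _ _ _ "{0<..}"])
      (use assms in \<open>auto simp: recip_log_def\<close>)
  then show ?thesis using assms by (simp add: recip_log_def)
qed

lemma tendsto_recip_log_0: "(recip_log \<longlongrightarrow> 0) (at 0)"
proof -
  have "((\<lambda>s::real. 1 / (24 - ln s)) \<longlongrightarrow> 0) (at_right 0)" by real_asymp
  then have "(recip_log \<longlongrightarrow> 0) (at_right 0)"
    by (rule Lim_transform_eventually)
      (auto simp: recip_log_def eventually_at_right_less eventually_at_filter)
  moreover have "(recip_log \<longlongrightarrow> 0) (at_left 0)"
    by (rule tendsto_eventually) (auto simp: recip_log_def eventually_at_filter)
  ultimately show ?thesis by (simp add: filterlim_split_at)
qed

lemma continuous_on_recip_log: "continuous_on {..<1} recip_log"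
proof (intro continuous_at_imp_continuous_on ballI)
  fix s :: real assume s: "s \<in> {..<1}"
  consider "s = 0" | "0 < s" | "s < 0" by linarith
  then show "isCont recip_log s"
  proof cases
    case 1
    then show ?thesis using tendsto_recip_log_0 by (simp add: isCont_def recip_log_def)
  next
    case 2
    then show ?thesis using DERIV_recip_log s DERIV_isCont by auto
  next
    case 3
    then have "\<forall>\<^sub>F t in nhds s. recip_log t = 0"
      by (auto simp: recip_log_def eventually_nhds intro!: exI[of _ "{..<0}"])
    then have "isCont recip_log s \<longleftrightarrow> isCont (\<lambda>_. 0 :: real) s" by (rule isCont_cong)
    then show ?thesis by simp
  qed
qed

lemma log_power_at_0 [simp]: "log_power c k 0 = 0"
  by (simp add: log_power_def)

lemma log_power_pos: "0 < s \<Longrightarrow> s < 1 \<Longrightarrow> 0 < log_power c k s"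
  using recip_log_bounds(1)[of s] by (simp add: log_power_def)

lemma log_power_nonneg: "s < 1 \<Longrightarrow> 0 \<le> log_power c k s"
  using recip_log_nonneg[of s] by (simp add: log_power_def)

lemma log_power_antimono:
  assumes "j \<le> k" "0 < s" "s < 1"
  shows "log_power c k s \<le> log_power c j s"
proof -
  have "recip_log s ^ k \<le> recip_log s ^ j"
    using recip_log_bounds[OF assms(2,3)] assms(1) by (intro power_decreasing) auto
  then show ?thesis by (simp add: log_power_def mult_left_mono)
qed

lemma DERIV_log_power:
  assumes s: "0 < s" "s < 1"
  shows "(log_power c k has_real_derivative
    c * log_power (c - 1) k s + k * log_power (c - 1) (Suc k) s) (at s)"
proof -
  have "(log_power c k has_real_derivative (c * s powr (c - 1)) * recip_log s ^ k
      + (real k * recip_log s ^ (k - 1) * ((recip_log s)\<^sup>2 / s)) * s powr c) (at s)"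
    unfolding log_power_def[abs_def]
    by (intro DERIV_mult has_real_derivative_powr s(1))
      (use DERIV_power[OF DERIV_recip_log[OF s], of k] in \<open>simp add: mult_ac\<close>)
  moreover have "(real k * recip_log s ^ (k - 1) * ((recip_log s)\<^sup>2 / s)) * s powr c
      = k * log_power (c - 1) (Suc k) s"
    using s by (cases k) (auto simp: log_power_def powr_diff power2_eq_square)
  ultimately show ?thesis by (simp add: log_power_def mult_ac)
qed

lemma continuous_on_log_power: "continuous_on {0<..<1} (log_power c k)"
  by (intro continuous_at_imp_continuous_on ballI) (auto intro: DERIV_isCont[OF DERIV_log_power])

lemma measurable_recip_log [measurable]: "recip_log \<in> borel_measurable borel"
  unfolding recip_log_def[abs_def] by measurable

lemma measurable_log_power [measurable]: "log_power c k \<in> borel_measurable borel"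
  unfolding log_power_def[abs_def] by measurable

text \<open>On the dyadic shell \<open>2^(-k-1) \<le> |x| < 2^(-k)\<close>, of volume comparable to \<open>2^(-k n)\<close>, the function is at
  most \<open>2^((k+1) n) / (k+1)\<^sup>2\<close>; the exponent 2 of the logarithm makes the sum over the shells converge.\<close>

lemma integrable_log_power_critical:
  "integrable (lebesgue_on (ball (0::'a::euclidean_space) 1))
     (\<lambda>x. log_power (- (DIM('a) / 2)) 2 ((norm x)\<^sup>2))"
proof -
  define n where "n = DIM('a)"
  define h where "h x = indicator (ball 0 1) x * log_power (- (n / 2)) 2 ((norm x)\<^sup>2)" for x :: 'a
  define V where "V = measure lborel (ball (0::'a) 1)"
  define b where "b k = 2 ^ ((k + 1) * n) / (real k + 1)\<^sup>2" for k
  define B where "B k = ball (0::'a) ((1 / 2) ^ k)" for k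
  have h_nonneg: "0 \<le> h x" for x
    by (auto simp: h_def indicator_def power_less_one_iff intro!: log_power_nonneg)
  have [measurable]: "h \<in> borel_measurable lborel"
    unfolding h_def
    by (intro borel_measurable_times borel_measurable_indicator measurable_compose[OF _ measurable_log_power]) auto
  have b_nonneg: "0 \<le> b k" for k by (simp add: b_def)
  have shell: "h x \<le> b k" if x: "(1 / 2) ^ Suc k \<le> norm x" "norm x < (1 / 2) ^ k" for x k
  proof -
    have x0: "0 < norm x" using x(1) by (rule less_le_trans[rotated]) simp
    have x1: "norm x < 1" using x(2) by (rule less_le_trans) (simp add: power_le_one)
    have "((norm x)\<^sup>2) powr (- (n / 2)) = norm x powr - real n"
      using x0 by (simp add: powr_powr flip: powr_numeral)
    also have "\<dots> \<le> ((1 / 2) ^ Suc k) powr - real n"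
      using x(1) by (intro powr_mono2') auto
    also have "\<dots> = 2 ^ ((k + 1) * n)"
      by (simp add: powr_minus powr_realpow power_divide power_mult_distrib power_add flip: power_mult)
    finally have 1: "((norm x)\<^sup>2) powr (- (n / 2)) \<le> 2 ^ ((k + 1) * n)" .
    have "ln (norm x) \<le> ln ((1 / 2) ^ k)" using x(2) x0 by (subst ln_le_cancel_iff) auto
    also have "\<dots> = - (real k * ln 2)" by (simp add: ln_realpow ln_div)
    also have "\<dots> \<le> - (real k * (1 / 2))"
      using ln2_ge_two_thirds by (intro le_imp_neg_le mult_left_mono) auto
    finally have "real k + 1 \<le> 24 - ln ((norm x)\<^sup>2)" using x0 by (simp add: ln_realpow)
    then have "recip_log ((norm x)\<^sup>2) \<le> 1 / (real k + 1)"
      using x0 by (auto simp: recip_log_def intro!: divide_left_mono)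
    then have "(recip_log ((norm x)\<^sup>2))\<^sup>2 \<le> (1 / (real k + 1))\<^sup>2"
      using x1 by (intro power_mono recip_log_nonneg) (auto simp: power_less_one_iff)
    with 1 have "log_power (- (n / 2)) 2 ((norm x)\<^sup>2) \<le> 2 ^ ((k + 1) * n) * (1 / (real k + 1))\<^sup>2"
      unfolding log_power_def by (intro mult_mono) auto
    then show ?thesis using x1 by (simp add: h_def b_def power_divide)
  qed
  have le: "ennreal (h x) \<le> (\<Sum>k. ennreal (b k) * indicator (B k) x)" for x
  proof (cases "x = 0 \<or> 1 \<le> norm x")
    case True
    then have "h x = 0" by (auto simp: h_def)
    then show ?thesis by simp
  next
    case False
    define k where "k = (LEAST k. (1 / 2) ^ Suc k \<le> norm x)"
    have "\<exists>k. (1 / 2) ^ k < norm x"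
      using False by (intro real_arch_pow_inv) auto
    then obtain j where "(1 / 2) ^ j < norm x" ..
    then have "(1 / 2) ^ Suc j \<le> norm x" by (rule order_trans[OF _ less_imp_le, rotated]) simp
    then have k1: "(1 / 2) ^ Suc k \<le> norm x" unfolding k_def by (rule LeastI)
    have k2: "norm x < (1 / 2) ^ k"
    proof (cases k)
      case 0
      then show ?thesis using False by simp
    next
      case (Suc i)
      then have "\<not> (1 / 2) ^ Suc i \<le> norm x"
        using not_less_Least[of i "\<lambda>k. (1 / 2) ^ Suc k \<le> norm x"] unfolding k_def by auto
      then show ?thesis unfolding Suc by simp
    qed
    have "ennreal (h x) \<le> ennreal (b k) * indicator (B k) x"
      using shell[OF k1 k2] k2 b_nonneg by (simp add: B_def ennreal_leI)
    also have "\<dots> \<le> (\<Sum>k. ennreal (b k) * indicator (B k) x)"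
    proof -
      define f where "f k = ennreal (b k) * indicator (B k) x" for k
      have "sum f {k} \<le> suminf f" by (rule sum_le_suminf) auto
      then have "f k \<le> suminf f" by simp
      then show ?thesis unfolding f_def .
    qed
    finally show ?thesis .
  qed
  have vol: "ennreal (b k) * emeasure lborel (B k) = ennreal (2 ^ n * V * (1 / (real k + 1)\<^sup>2))" for k
  proof -
    have "emeasure lborel (B k) = ennreal (measure lborel (B k))"
      unfolding B_def by (rule emeasure_eq_ennreal_measure) (use emeasure_lborel_ball_finite in \<open>simp add: less_top\<close>)
    also have "measure lborel (B k) = ((1 / 2) ^ k) ^ n * V"
      unfolding B_def V_def n_def by (rule content_ball_conv_unit_ball) simp
    finally have "ennreal (b k) * emeasure lborel (B k) = ennreal (b k * (((1 / 2) ^ k) ^ n * V))"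
      using b_nonneg by (simp add: ennreal_mult V_def)
    also have "b k * (((1 / 2) ^ k) ^ n * V) = 2 ^ n * V * (1 / (real k + 1)\<^sup>2)"
      by (simp add: b_def power_add power_divide flip: power_mult)
    finally show ?thesis .
  qed
  have "(\<integral>\<^sup>+x. ennreal (h x) \<partial>lborel) \<le> (\<integral>\<^sup>+x. (\<Sum>k. ennreal (b k) * indicator (B k) x) \<partial>lborel)"
    using le by (rule nn_integral_mono)
  also have "\<dots> = (\<Sum>k. \<integral>\<^sup>+x. ennreal (b k) * indicator (B k) x \<partial>lborel)"
    by (rule nn_integral_suminf)
      (auto intro!: borel_measurable_times_ennreal borel_measurable_indicator simp: B_def)
  also have "\<dots> = (\<Sum>k. ennreal (2 ^ n * V * (1 / (real k + 1)\<^sup>2)))"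
    unfolding vol[symmetric] by (simp add: nn_integral_cmult_indicator B_def)
  also have "\<dots> < \<infinity>"
  proof -
    have "summable (\<lambda>k. 1 / (real k + 1)\<^sup>2)"
      using summable_Suc_iff[of "\<lambda>k. inverse (real k ^ 2)"] inverse_power_summable[of 2, where 'a = real]
      by (simp add: inverse_eq_divide add.commute)
    then have "summable (\<lambda>k. 2 ^ n * V * (1 / (real k + 1)\<^sup>2))" by (rule summable_mult)
    then have "(\<Sum>k. ennreal (2 ^ n * V * (1 / (real k + 1)\<^sup>2))) \<noteq> top"
      by (rule ennreal_suminf_neq_top) (simp add: V_def)
    then show ?thesis by (simp add: less_top)
  qed
  finally have "integrable lborel h"
    using h_nonneg by (intro integrableI_nonneg) auto
  then have "integrable lebesgue h" by (subst integrable_completion) auto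
  moreover have "h = (\<lambda>x. if x \<in> ball 0 1 then log_power (- (n / 2)) 2 ((norm x)\<^sup>2) else 0)"
    by (auto simp: h_def)
  ultimately show ?thesis
    using Lebesgue_Measure.integrable_restrict_UNIV[of "ball 0 1" "\<lambda>x::'a. log_power (- (n / 2)) 2 ((norm x)\<^sup>2)"]
    unfolding n_def by simp
qed

section \<open>The singular solution and its flux\<close>

text \<open>The profiles are functions of \<open>s = |x|\<^sup>2\<close>, so \<open>s powr (- n / 2)\<close> is \<open>|x|^(-n)\<close>. One logarithm is lost to
  the logarithm of the gradient, and more than one must remain for integrability; hence the exponent 3.\<close>

definition amplitude :: "real \<Rightarrow> real \<Rightarrow> real" where
  "amplitude n s = log_power (- (n / 2)) 3 s"

definition amplitude' :: "real \<Rightarrow> real \<Rightarrow> real" where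
  "amplitude' n s = - (n / 2) * log_power (- (n / 2) - 1) 3 s + 3 * log_power (- (n / 2) - 1) 4 s"

text \<open>Let \<open>F = amplitude n\<close>, \<open>u = (x \<bullet> e) F(s)\<close>, and let \<open>A\<close> have eigenvalue 1 in the radial direction and \<open>\<beta>\<close> in the
  tangential ones. Then \<open>A \<nabla>u\<close> has radial part \<open>(x \<bullet> e) q x / s\<close> with \<open>q = F + 2 s F'\<close>, and tangential part
  \<open>\<beta> F (e - (x \<bullet> e) x / s)\<close>. Its divergence vanishes precisely if \<open>\<beta> F = q + 2 s q' / (n - 1)\<close>, and the
  formula below is the solution of this equation for \<open>\<beta>\<close>.\<close>

definition tangential_coeff :: "real \<Rightarrow> real \<Rightarrow> real" where
  "tangential_coeff n s = 1 - 6 * n / (n - 1) * recip_log s + 48 / (n - 1) * (recip_log s)\<^sup>2"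

text \<open>In the notation above \<open>A \<nabla>u = flux_e e + flux_x (x \<bullet> e) x\<close>, where \<open>flux_e = \<beta> F\<close> and
  \<open>flux_x = (q - \<beta> F) / s\<close>.\<close>

definition flux_e :: "real \<Rightarrow> real \<Rightarrow> real" where
  "flux_e n s = log_power (- (n / 2)) 3 s - 6 * n / (n - 1) * log_power (- (n / 2)) 4 s
     + 48 / (n - 1) * log_power (- (n / 2)) 5 s"

definition flux_e' :: "real \<Rightarrow> real \<Rightarrow> real" where
  "flux_e' n s =
     - (n / 2) * log_power (- (n / 2) - 1) 3 s + 3 * log_power (- (n / 2) - 1) 4 s
     - 6 * n / (n - 1) * (- (n / 2) * log_power (- (n / 2) - 1) 4 s + 4 * log_power (- (n / 2) - 1) 5 s)
     + 48 / (n - 1) * (- (n / 2) * log_power (- (n / 2) - 1) 5 s + 5 * log_power (- (n / 2) - 1) 6 s)"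

definition flux_x :: "real \<Rightarrow> real \<Rightarrow> real" where
  "flux_x n s = - n * log_power (- (n / 2) - 1) 3 s
     + (6 + 6 * n / (n - 1)) * log_power (- (n / 2) - 1) 4 s
     - 48 / (n - 1) * log_power (- (n / 2) - 1) 5 s"

definition flux_x' :: "real \<Rightarrow> real \<Rightarrow> real" where
  "flux_x' n s =
     - n * ((- (n / 2) - 1) * log_power (- (n / 2) - 2) 3 s + 3 * log_power (- (n / 2) - 2) 4 s)
     + (6 + 6 * n / (n - 1))
       * ((- (n / 2) - 1) * log_power (- (n / 2) - 2) 4 s + 4 * log_power (- (n / 2) - 2) 5 s)
     - 48 / (n - 1) * ((- (n / 2) - 1) * log_power (- (n / 2) - 2) 5 s + 5 * log_power (- (n / 2) - 2) 6 s)"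

lemma DERIV_amplitude:
  assumes "0 < s" "s < 1"
  shows "(amplitude n has_real_derivative amplitude' n s) (at s)"
  using DERIV_log_power[OF assms, of "- (n / 2)" 3]
  unfolding amplitude_def[abs_def] amplitude'_def by simp

lemma DERIV_flux_e:
  assumes "0 < s" "s < 1"
  shows "(flux_e n has_real_derivative flux_e' n s) (at s)"
proof -
  note D = DERIV_log_power[OF assms, of "- (n / 2)"]
  show ?thesis
    unfolding flux_e_def[abs_def] flux_e'_def
    using DERIV_add[OF DERIV_diff[OF D[of 3] DERIV_cmult[OF D[of 4], of "6 * n / (n - 1)"]]
        DERIV_cmult[OF D[of 5], of "48 / (n - 1)"]]
    by simp
qed

lemma DERIV_flux_x:
  assumes "0 < s" "s < 1"
  shows "(flux_x n has_real_derivative flux_x' n s) (at s)"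
proof -
  have "- (n / 2) - 1 - 1 = - (n / 2) - 2" by simp
  note D = DERIV_log_power[OF assms, of "- (n / 2) - 1", unfolded this]
  show ?thesis
    unfolding flux_x_def[abs_def] flux_x'_def
    using DERIV_diff[OF DERIV_add[OF DERIV_cmult[OF D[of 3], of "- n"]
          DERIV_cmult[OF D[of 4], of "6 + 6 * n / (n - 1)"]] DERIV_cmult[OF D[of 5], of "48 / (n - 1)"]]
    by (simp only: of_nat_numeral Suc_numeral add_num_simps)
qed

lemma log_power_split:
  assumes "0 < s"
  shows "log_power c k s = s powr c * recip_log s ^ k"
    and "log_power (c - 1) k s = s powr c / s * recip_log s ^ k"
    and "log_power (c - 2) k s = s powr c / s\<^sup>2 * recip_log s ^ k"
  using assms by (simp_all add: log_power_def powr_diff power2_eq_square)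

lemma tangential_coeff_amplitude:
  assumes "0 < s"
  shows "tangential_coeff n s * amplitude n s = flux_e n s"
  unfolding tangential_coeff_def amplitude_def flux_e_def log_power_split(1)[OF assms]
  by (simp add: algebra_simps eval_nat_numeral)

lemma flux_x_eq:
  assumes "0 < s"
  shows "2 * tangential_coeff n s * amplitude' n s
    + (1 - tangential_coeff n s) / s * (amplitude n s + 2 * s * amplitude' n s) = flux_x n s"
proof -
  define A B T P where "A = 6 * n / (n - 1)" and "B = 48 / (n - 1)"
    and "T = recip_log s" and "P = s powr (- (n / 2))"
  show ?thesis
    unfolding tangential_coeff_def amplitude_def amplitude'_def flux_x_def log_power_split[OF assms, of "- (n / 2)"]
      A_def[symmetric] B_def[symmetric] T_def[symmetric] P_def[symmetric]
    using assms by (simp add: field_simps eval_nat_numeral)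
qed

text \<open>The left-hand side is the divergence of \<open>singular_flux\<close> divided by \<open>x \<bullet> e\<close>. The terms with the third
  power of \<open>T = recip_log s\<close> cancel because \<open>(x \<bullet> e) |x|^(-n)\<close> is harmonic; the coefficients \<open>A\<close> and \<open>B\<close> are
  those that remove the fourth and the fifth power, and the sixth powers of the two derivatives cancel.\<close>

lemma flux_divergence:
  assumes "1 < n" "0 < s"
  shows "2 * flux_e' n s + (n + 1) * flux_x n s + 2 * s * flux_x' n s = 0"
proof -
  define A B T P where "A = 6 * n / (n - 1)" and "B = 48 / (n - 1)"
    and "T = recip_log s" and "P = s powr (- (n / 2))"
  have AB: "A * n = 6 * n + A" "B * n = 48 + B"
    using assms(1) by (auto simp: A_def B_def field_simps)
  have "s * (2 * flux_e' n s + (n + 1) * flux_x n s + 2 * s * flux_x' n s)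
     = P * T ^ 4 * (A * n - 6 * n - A) + P * T ^ 5 * (48 + B - B * n)"
    unfolding flux_e'_def flux_x_def flux_x'_def log_power_split[OF assms(2), of "- (n / 2)"]
      A_def[symmetric] B_def[symmetric] T_def[symmetric] P_def[symmetric]
    using assms(2) by (simp add: field_simps eval_nat_numeral)
  also have "\<dots> = 0" using AB by simp
  finally show ?thesis using assms(2) by simp
qed

definition singular_solution :: "'a::euclidean_space \<Rightarrow> 'a \<Rightarrow> real" where
  "singular_solution e x = (x \<bullet> e) * amplitude DIM('a) ((norm x)\<^sup>2)"

definition singular_gradient :: "'a::euclidean_space \<Rightarrow> 'a \<Rightarrow> 'a" where
  "singular_gradient e x = amplitude DIM('a) ((norm x)\<^sup>2) *\<^sub>R e
     + (2 * amplitude' DIM('a) ((norm x)\<^sup>2) * (x \<bullet> e)) *\<^sub>R x"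

definition singular_flux :: "'a::euclidean_space \<Rightarrow> 'a \<Rightarrow> 'a" where
  "singular_flux e x = flux_e DIM('a) ((norm x)\<^sup>2) *\<^sub>R e
     + (flux_x DIM('a) ((norm x)\<^sup>2) * (x \<bullet> e)) *\<^sub>R x"

lemma norm_power2_in_unit_interval:
  assumes "x \<in> ball 0 1 - {0}"
  shows "0 < (norm x)\<^sup>2" "(norm x)\<^sup>2 < 1"
  using assms by (auto simp: power_less_one_iff)

lemma GDERIV_inner_left: "GDERIV (\<lambda>x. x \<bullet> e) x :> e"
  unfolding gderiv_def by (auto intro!: derivative_eq_intros)

lemma GDERIV_radial:
  assumes "(f has_real_derivative f') (at ((norm x)\<^sup>2))"
  shows "GDERIV (\<lambda>x. f ((norm x)\<^sup>2)) x :> (2 * f') *\<^sub>R x"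
  using GDERIV_DERIV_compose[OF GDERIV_norm_power2 assms] by (simp add: mult.commute)

lemma GDERIV_singular_solution:
  assumes "x \<in> ball 0 1 - {0}"
  shows "GDERIV (singular_solution e) x :> singular_gradient e x"
  using GDERIV_mult[OF GDERIV_inner_left[of e x]
      GDERIV_radial[OF DERIV_amplitude[OF norm_power2_in_unit_interval[OF assms]]]]
  unfolding singular_solution_def[abs_def] singular_gradient_def
  by (simp add: algebra_simps)

lemma continuous_on_log_power_norm:
  "continuous_on (ball 0 1 - {0}) (\<lambda>x. log_power c k ((norm x)\<^sup>2))"
  by (rule continuous_on_compose2[OF continuous_on_log_power, of _ "\<lambda>x. (norm x)\<^sup>2"])
    (auto intro!: continuous_intros simp: power_less_one_iff)

lemma continuous_on_singular_gradient: "continuous_on (ball 0 1 - {0}) (singular_gradient e)"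
  unfolding singular_gradient_def[abs_def] amplitude_def amplitude'_def
  by (intro continuous_intros continuous_on_log_power_norm)

lemma measurable_log_power_norm [measurable]:
  "(\<lambda>x::'a::euclidean_space. log_power c k ((norm x)\<^sup>2)) \<in> borel_measurable borel"
  by (rule measurable_compose[OF _ measurable_log_power]) simp

lemma measurable_singular:
  fixes e :: "'a::euclidean_space"
  shows "singular_solution e \<in> borel_measurable borel" "singular_gradient e \<in> borel_measurable borel"
    "singular_flux e \<in> borel_measurable borel"
  unfolding singular_solution_def[abs_def] singular_gradient_def[abs_def] singular_flux_def[abs_def]
    amplitude_def amplitude'_def flux_e_def flux_x_def
  by measurable

section \<open>Pointwise bounds\<close>

lemma amplitude_bounds:
  assumes "0 < s" "s < 1"
  shows "0 < amplitude n s" "amplitude n s \<le> log_power (- (n / 2)) 2 s"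
  using log_power_pos[OF assms] log_power_antimono[OF _ assms, of 2 3] by (auto simp: amplitude_def)

lemma amplitude'_eq:
  assumes "0 < s"
  shows "2 * s * amplitude' n s = amplitude n s * (6 * recip_log s - n)"
  unfolding amplitude'_def amplitude_def log_power_split[OF assms, of "- (n / 2)"]
  using assms by (simp add: field_simps eval_nat_numeral)

lemma flux_x_amplitude:
  assumes "0 < s"
  shows "s * flux_x n s = amplitude n s * (1 - n + 6 * recip_log s - tangential_coeff n s)"
proof -
  define A B where "A = 6 * n / (n - 1)" and "B = 48 / (n - 1)"
  show ?thesis
    unfolding flux_x_def amplitude_def tangential_coeff_def log_power_split[OF assms, of "- (n / 2)"]
      A_def[symmetric] B_def[symmetric]
    using assms by (simp add: field_simps eval_nat_numeral)
qed

lemma tangential_coeff_bounds: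
  assumes "2 \<le> n" "s < 1"
  shows "1 / 2 \<le> tangential_coeff n s" "tangential_coeff n s \<le> 2"
proof -
  define T where "T = recip_log s"
  have T: "0 \<le> T" "T \<le> 1 / 24"
    using recip_log_nonneg[OF assms(2)] recip_log_bounds(2)[of s] assms(2)
    by (cases "0 < s"; auto simp: T_def recip_log_def)+
  have A: "0 \<le> 6 * n / (n - 1)" "6 * n / (n - 1) \<le> 12" and B: "0 \<le> 48 / (n - 1)" "48 / (n - 1) \<le> 48"
    using assms(1) by (auto simp: field_simps)
  have "6 * n / (n - 1) * T \<le> 12 * (1 / 24)" using A T by (intro mult_mono) auto
  moreover have "0 \<le> 6 * n / (n - 1) * T" by (rule mult_nonneg_nonneg[OF A(1) T(1)])
  moreover have "T\<^sup>2 \<le> (1 / 24)\<^sup>2" using T by (intro power_mono) auto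
  then have "48 / (n - 1) * T\<^sup>2 \<le> 48 * (1 / 24)\<^sup>2" using B by (intro mult_mono) auto
  moreover have "0 \<le> 48 / (n - 1) * T\<^sup>2" by (rule mult_nonneg_nonneg[OF B(1) zero_le_power2])
  ultimately show "1 / 2 \<le> tangential_coeff n s" "tangential_coeff n s \<le> 2"
    unfolding tangential_coeff_def T_def[symmetric] by (auto simp: power2_eq_square)
qed

lemma norm_e_x_combination:
  fixes e x :: "'a::real_inner"
  assumes "norm e = 1"
  shows "norm (a *\<^sub>R e + (b * (x \<bullet> e)) *\<^sub>R x) \<le> \<bar>a\<bar> + \<bar>(norm x)\<^sup>2 * b\<bar>"
proof -
  have "\<bar>x \<bullet> e\<bar> \<le> norm x" using Cauchy_Schwarz_ineq2[of x e] assms by simp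
  then have "\<bar>b\<bar> * \<bar>x \<bullet> e\<bar> * norm x \<le> \<bar>b\<bar> * norm x * norm x"
    by (intro mult_right_mono mult_left_mono) auto
  then have "norm ((b * (x \<bullet> e)) *\<^sub>R x) \<le> \<bar>(norm x)\<^sup>2 * b\<bar>"
    by (simp add: abs_mult power2_eq_square mult_ac)
  then show ?thesis using norm_triangle_ineq[of "a *\<^sub>R e" "(b * (x \<bullet> e)) *\<^sub>R x"] assms by simp
qed

lemma singular_at_0 [simp]:
  "singular_solution e 0 = 0" "singular_gradient e 0 = 0" "singular_flux e 0 = 0"
  by (simp_all add: singular_solution_def singular_gradient_def singular_flux_def amplitude_def flux_e_def)

lemma norm_singular_gradient_le:
  fixes e :: "'a::euclidean_space"
  assumes e: "norm e = 1" and x: "x \<in> ball 0 1"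
  shows "norm (singular_gradient e x) \<le> (DIM('a) + 3) * amplitude DIM('a) ((norm x)\<^sup>2)"
proof (cases "x = 0")
  case False
  define s where "s = (norm x)\<^sup>2"
  have s: "0 < s" "s < 1" using norm_power2_in_unit_interval[of x] x False by (auto simp: s_def)
  define F where "F = amplitude DIM('a) s"
  have F: "0 < F" unfolding F_def by (rule amplitude_bounds[OF s])
  have "\<bar>s * (2 * amplitude' DIM('a) s)\<bar> = F * \<bar>6 * recip_log s - DIM('a)\<bar>"
    using amplitude'_eq[OF s(1), of "DIM('a)"] F by (simp add: abs_mult F_def mult_ac)
  also have "\<dots> \<le> F * (DIM('a) + 1)"
    using recip_log_bounds[OF s] F by (intro mult_left_mono) auto
  finally have "norm (singular_gradient e x) \<le> \<bar>F\<bar> + F * (DIM('a) + 1)"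
    using norm_e_x_combination[OF e, of F "2 * amplitude' DIM('a) s" x]
    by (simp add: singular_gradient_def s_def F_def)
  then show ?thesis using F unfolding s_def[symmetric] F_def[symmetric] by (simp add: algebra_simps)
qed (simp add: amplitude_def)

lemma norm_singular_flux_le:
  fixes e :: "'a::euclidean_space"
  assumes e: "norm e = 1" and x: "x \<in> ball 0 1" and dim: "2 \<le> DIM('a)"
  shows "norm (singular_flux e x) \<le> (DIM('a) + 5) * amplitude DIM('a) ((norm x)\<^sup>2)"
proof (cases "x = 0")
  case False
  define s where "s = (norm x)\<^sup>2"
  have s: "0 < s" "s < 1" using norm_power2_in_unit_interval[of x] x False by (auto simp: s_def)
  define F where "F = amplitude DIM('a) s"
  have F: "0 < F" unfolding F_def by (rule amplitude_bounds[OF s])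
  have "2 \<le> real DIM('a)" using dim by simp
  note c = tangential_coeff_bounds[OF this s(2)]
  have "flux_e DIM('a) s = F * tangential_coeff DIM('a) s"
    using tangential_coeff_amplitude[OF s(1), of "DIM('a)"] by (simp add: F_def mult.commute)
  then have "\<bar>flux_e DIM('a) s\<bar> = F * tangential_coeff DIM('a) s"
    using F c by simp
  also have "\<dots> \<le> F * 2" using c F by (intro mult_left_mono) auto
  finally have 1: "\<bar>flux_e DIM('a) s\<bar> \<le> F * 2" .
  have "\<bar>s * flux_x DIM('a) s\<bar> = F * \<bar>1 - real DIM('a) + 6 * recip_log s - tangential_coeff DIM('a) s\<bar>"
    using flux_x_amplitude[OF s(1), of "DIM('a)"] F by (simp add: abs_mult F_def)
  also have "\<dots> \<le> F * (DIM('a) + 3)"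
    using recip_log_bounds[OF s] c F by (intro mult_left_mono) auto
  finally have "norm (singular_flux e x) \<le> F * 2 + F * (DIM('a) + 3)"
    using norm_e_x_combination[OF e, of "flux_e DIM('a) s" "flux_x DIM('a) s" x] 1
    by (simp add: singular_flux_def s_def)
  then show ?thesis unfolding s_def[symmetric] F_def[symmetric] by (simp add: algebra_simps)
qed (simp add: amplitude_def)

text \<open>Divided by the amplitude, the gradient has a tangential part of length \<open>sin \<alpha>\<close> and a radial part
  of length at least \<open>(n - 1 - 1/4) |cos \<alpha>|\<close>, where \<open>\<alpha>\<close> is the angle between \<open>x\<close> and \<open>e\<close>. So it
  vanishes in no direction.\<close>

lemma norm_singular_gradient_ge:
  fixes e :: "'a::euclidean_space"
  assumes e: "norm e = 1" and x: "x \<in> ball 0 1 - {0}" and dim: "2 \<le> DIM('a)"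
  shows "3 / 4 * amplitude DIM('a) ((norm x)\<^sup>2) \<le> norm (singular_gradient e x)"
proof -
  define s where "s = (norm x)\<^sup>2"
  have s: "0 < s" "s < 1" using norm_power2_in_unit_interval[OF x] by (auto simp: s_def)
  define F where "F = amplitude DIM('a) s"
  define G where "G = amplitude' DIM('a) s"
  define y where "y = x \<bullet> e"
  have F: "0 < F" unfolding F_def by (rule amplitude_bounds[OF s])
  have xx: "x \<bullet> x = s" and ee: "e \<bullet> e = 1" and ex: "e \<bullet> x = y"
    using e by (simp_all add: s_def y_def power2_norm_eq_inner norm_eq_1 inner_commute)
  have "\<bar>y\<bar> \<le> norm x" using Cauchy_Schwarz_ineq2[of x e] e by (simp add: y_def)
  then have y: "y\<^sup>2 \<le> s" unfolding s_def using power_mono[of "\<bar>y\<bar>" "norm x" 2] by simp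
  have "F + 2 * s * G = F * (1 - real DIM('a) + 6 * recip_log s)"
    using amplitude'_eq[OF s(1), of "DIM('a)"] by (simp add: F_def G_def algebra_simps)
  moreover have "(3 / 4)\<^sup>2 \<le> (1 - real DIM('a) + 6 * recip_log s)\<^sup>2"
    using recip_log_bounds[OF s] dim power_mono[of "3 / 4" "- (1 - real DIM('a) + 6 * recip_log s)" 2]
    unfolding power2_minus by simp
  then have "F\<^sup>2 * (3 / 4)\<^sup>2 \<le> F\<^sup>2 * (1 - real DIM('a) + 6 * recip_log s)\<^sup>2"
    by (intro mult_left_mono) auto
  ultimately have q: "9 / 16 * F\<^sup>2 \<le> (F + 2 * s * G)\<^sup>2"
    by (simp add: power_mult_distrib power_divide mult.commute)
  have "singular_gradient e x = F *\<^sub>R e + (2 * G * y) *\<^sub>R x"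
    by (simp add: singular_gradient_def s_def F_def G_def y_def)
  then have "(norm (singular_gradient e x))\<^sup>2 = F\<^sup>2 + 4 * F * G * y\<^sup>2 + 4 * G\<^sup>2 * y\<^sup>2 * s"
    unfolding power2_norm_eq_inner
    by (simp add: inner_add_left inner_add_right xx ee ex y_def[symmetric] power2_eq_square algebra_simps)
  then have "s * (norm (singular_gradient e x))\<^sup>2 = s * F\<^sup>2 + y\<^sup>2 * ((F + 2 * s * G)\<^sup>2 - F\<^sup>2)"
    by (simp add: power2_eq_square algebra_simps)
  also have "\<dots> \<ge> s * F\<^sup>2 + y\<^sup>2 * (9 / 16 * F\<^sup>2 - F\<^sup>2)"
    using q by (intro add_left_mono mult_left_mono) auto
  also have "y\<^sup>2 * (7 / 16 * F\<^sup>2) \<le> s * (7 / 16 * F\<^sup>2)" using y by (intro mult_right_mono) auto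
  then have "s * F\<^sup>2 + y\<^sup>2 * (9 / 16 * F\<^sup>2 - F\<^sup>2) \<ge> s * (9 / 16 * F\<^sup>2)" by (simp add: algebra_simps)
  finally have "(3 / 4 * F)\<^sup>2 \<le> (norm (singular_gradient e x))\<^sup>2"
    using s(1) by (simp add: power_mult_distrib power2_eq_square)
  then show ?thesis unfolding s_def[symmetric] F_def[symmetric] by (rule power2_le_imp_le) simp
qed

section \<open>The weak gradient and the weak equation\<close>

lemma integrable_lebesgue_on_subset:
  fixes f :: "'a::euclidean_space \<Rightarrow> 'b::euclidean_space"
  assumes f: "integrable (lebesgue_on T) f" and "S \<subseteq> T" "S \<in> sets lebesgue" "T \<in> sets lebesgue"
  shows "integrable (lebesgue_on S) f"
proof -
  have "integrable lebesgue (\<lambda>x. if x \<in> T then f x else 0)"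
    using f assms(4) Lebesgue_Measure.integrable_restrict_UNIV by blast
  then have "integrable lebesgue (\<lambda>x. indicator S x *\<^sub>R (if x \<in> T then f x else 0))"
    using assms(3) by (rule integrable_mult_indicator[rotated])
  moreover have "(\<lambda>x. indicator S x *\<^sub>R (if x \<in> T then f x else 0)) = (\<lambda>x. if x \<in> S then f x else 0)"
    using assms(2) by (auto simp: fun_eq_iff indicator_def)
  ultimately show ?thesis
    using assms(3) Lebesgue_Measure.integrable_restrict_UNIV[of S f] by simp
qed

lemma borel_imp_lebesgue_on_measurable:
  "f \<in> borel_measurable borel \<Longrightarrow> f \<in> borel_measurable (lebesgue_on S)"
  by (intro measurable_restrict_space1 measurable_completion) simp

lemma integrable_dominated_by_log_power:
  fixes f :: "'a::euclidean_space \<Rightarrow> 'b::euclidean_space"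
  assumes f: "f \<in> borel_measurable borel"
    and le: "\<And>x. x \<in> ball 0 1 - {0} \<Longrightarrow> norm (f x) \<le> C * log_power (- (DIM('a) / 2)) 2 ((norm x)\<^sup>2)"
  shows "integrable (lebesgue_on (ball 0 1)) f"
proof (rule Bochner_Integration.integrable_bound)
  show "integrable (lebesgue_on (ball 0 1)) (\<lambda>x::'a. C * log_power (- (DIM('a) / 2)) 2 ((norm x)\<^sup>2))"
    using integrable_log_power_critical by (intro integrable_mult_right) auto
  show "AE x in lebesgue_on (ball 0 1). norm (f x) \<le> norm (C * log_power (- (DIM('a) / 2)) 2 ((norm x)\<^sup>2))"
  proof (subst AE_restrict_space_iff)
    show "AE x in lebesgue. x \<in> ball 0 1 \<longrightarrow> norm (f x) \<le> norm (C * log_power (- (DIM('a) / 2)) 2 ((norm x)\<^sup>2))"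
      using AE_lebesgue_neq_0
    proof eventually_elim
      case (elim x)
      then show ?case using le[of x] unfolding real_norm_def by (auto intro: order_trans[OF _ abs_ge_self])
    qed
  qed simp
qed (rule borel_imp_lebesgue_on_measurable[OF f])

lemma Lp_loc_1_dominated_by_log_power:
  fixes f :: "'a::euclidean_space \<Rightarrow> 'b::euclidean_space"
  assumes f: "f \<in> borel_measurable borel"
    and le: "\<And>x. x \<in> ball 0 1 - {0} \<Longrightarrow> norm (f x) \<le> C * log_power (- (DIM('a) / 2)) 2 ((norm x)\<^sup>2)"
  shows "f \<in> Lp_loc 1 (ball 0 1)"
proof -
  have "integrable (lebesgue_on (ball 0 1)) f"
    by (rule integrable_dominated_by_log_power[OF f le])
  then have "integrable (lebesgue_on K) f" if "compact K" "K \<subseteq> ball 0 1" for K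
    by (rule integrable_lebesgue_on_subset) (use that in \<open>auto simp: compact_imp_closed\<close>)
  then show ?thesis
    unfolding Lp_loc_def using borel_imp_lebesgue_on_measurable[OF f] by simp
qed

lemma Lp_loc_1_singular:
  fixes e :: "'a::euclidean_space"
  assumes e: "norm e = 1" and dim: "2 \<le> DIM('a)"
  shows "singular_solution e \<in> Lp_loc 1 (ball 0 1)"
    and "(\<lambda>x. singular_solution e x / norm x) \<in> Lp_loc 1 (ball 0 1)"
    and "singular_gradient e \<in> Lp_loc 1 (ball 0 1)"
    and "singular_flux e \<in> Lp_loc 1 (ball 0 1)"
proof -
  note [measurable] = measurable_singular[of e]
  have F: "0 < amplitude DIM('a) ((norm x)\<^sup>2)"
      "amplitude DIM('a) ((norm x)\<^sup>2) \<le> log_power (- (DIM('a) / 2)) 2 ((norm x)\<^sup>2)"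
    if "x \<in> ball 0 1 - {0}" for x :: 'a
    using amplitude_bounds[OF norm_power2_in_unit_interval[OF that]] by auto
  have u: "\<bar>singular_solution e x\<bar> \<le> norm x * amplitude DIM('a) ((norm x)\<^sup>2)" if "x \<in> ball 0 1 - {0}" for x
  proof -
    have "\<bar>x \<bullet> e\<bar> \<le> norm x" using Cauchy_Schwarz_ineq2[of x e] e by simp
    then show ?thesis
      unfolding singular_solution_def abs_mult using F(1)[OF that] by (simp add: mult_right_mono)
  qed
  show "singular_solution e \<in> Lp_loc 1 (ball 0 1)"
  proof (rule Lp_loc_1_dominated_by_log_power[where C = 1])
    fix x :: 'a assume x: "x \<in> ball 0 1 - {0}"
    have "norm x * amplitude DIM('a) ((norm x)\<^sup>2) \<le> 1 * amplitude DIM('a) ((norm x)\<^sup>2)"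
      using x F(1)[OF x] by (intro mult_right_mono) auto
    then show "norm (singular_solution e x) \<le> 1 * log_power (- (DIM('a) / 2)) 2 ((norm x)\<^sup>2)"
      using u[OF x] F(2)[OF x] by simp
  qed simp
  show "(\<lambda>x. singular_solution e x / norm x) \<in> Lp_loc 1 (ball 0 1)"
  proof (rule Lp_loc_1_dominated_by_log_power[where C = 1])
    fix x :: 'a assume x: "x \<in> ball 0 1 - {0}"
    have "\<bar>singular_solution e x\<bar> / norm x \<le> amplitude DIM('a) ((norm x)\<^sup>2)"
      using u[OF x] x by (simp add: field_simps)
    then show "norm (singular_solution e x / norm x) \<le> 1 * log_power (- (DIM('a) / 2)) 2 ((norm x)\<^sup>2)"
      using F(2)[OF x] by simp
  qed measurable
  show "singular_gradient e \<in> Lp_loc 1 (ball 0 1)"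
  proof (rule Lp_loc_1_dominated_by_log_power[where C = "DIM('a) + 3"])
    fix x :: 'a assume x: "x \<in> ball 0 1 - {0}"
    show "norm (singular_gradient e x) \<le> (DIM('a) + 3) * log_power (- (DIM('a) / 2)) 2 ((norm x)\<^sup>2)"
      by (rule order_trans[OF norm_singular_gradient_le[OF e _]]) (use x F(2)[OF x] in \<open>auto intro!: mult_left_mono\<close>)
  qed simp
  show "singular_flux e \<in> Lp_loc 1 (ball 0 1)"
  proof (rule Lp_loc_1_dominated_by_log_power[where C = "DIM('a) + 5"])
    fix x :: 'a assume x: "x \<in> ball 0 1 - {0}"
    show "norm (singular_flux e x) \<le> (DIM('a) + 5) * log_power (- (DIM('a) / 2)) 2 ((norm x)\<^sup>2)"
      by (rule order_trans[OF norm_singular_flux_le[OF e _ dim]]) (use x F(2)[OF x] in \<open>auto intro!: mult_left_mono\<close>)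
  qed simp
qed

lemma has_weak_gradient_singular:
  fixes e :: "'a::euclidean_space"
  assumes e: "norm e = 1" and dim: "2 \<le> DIM('a)"
  shows "has_weak_gradient (ball 0 1) (singular_solution e) (singular_gradient e)"
  unfolding has_weak_gradient_def
proof (intro conjI ballI)
  note L = Lp_loc_1_singular[OF e dim]
  show "singular_solution e \<in> Lp_loc 1 (ball 0 1)" "singular_gradient e \<in> Lp_loc 1 (ball 0 1)"
    by (rule L)+
  fix \<phi> :: "'a \<Rightarrow> real" and i :: 'a assume "\<phi> \<in> C1c (ball 0 1)"
  with GDERIV_singular_solution continuous_on_singular_gradient L(1,3,2)
  show "(\<integral>x. singular_solution e x * (gradient \<phi> x \<bullet> i) \<partial>lebesgue_on (ball 0 1))
      = - (\<integral>x. singular_gradient e x \<bullet> i * \<phi> x \<partial>lebesgue_on (ball 0 1))"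
    by (rule integration_by_parts_across_0[OF open_ball])
qed

lemma singular_flux_weakly_divergence_free:
  fixes e :: "'a::euclidean_space"
  assumes e: "norm e = 1" and dim: "2 \<le> DIM('a)" and \<phi>: "\<phi> \<in> C1c (ball 0 1)"
  shows "(\<integral>x. singular_flux e x \<bullet> gradient \<phi> x \<partial>lebesgue_on (ball 0 1)) = 0"
proof -
  define J where "J i x = (2 * flux_e' DIM('a) ((norm x)\<^sup>2) * (e \<bullet> i)) *\<^sub>R x
    + (2 * flux_x' DIM('a) ((norm x)\<^sup>2) * (x \<bullet> e) * (x \<bullet> i)) *\<^sub>R x
    + (flux_x DIM('a) ((norm x)\<^sup>2) * (x \<bullet> i)) *\<^sub>R e
    + (flux_x DIM('a) ((norm x)\<^sup>2) * (x \<bullet> e)) *\<^sub>R i" for i x :: 'a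
  show ?thesis
  proof (rule even_divergence_free_across_0[OF open_ball _ _ _ _ _ Lp_loc_1_singular(4)[OF e dim] \<phi>,
        where J = J])
    show "- x \<in> ball 0 1" if "x \<in> ball 0 1" for x :: 'a using that by simp
    show "singular_flux e (- x) = singular_flux e x" for x by (simp add: singular_flux_def)
    show "GDERIV (\<lambda>x. singular_flux e x \<bullet> i) x :> J i x" if x: "x \<in> ball 0 1 - {0}" for i x
    proof -
      note s = norm_power2_in_unit_interval[OF x]
      note a = GDERIV_mult[OF GDERIV_radial[OF DERIV_flux_e[OF s, of "DIM('a)"]] GDERIV_const[of "e \<bullet> i"]]
      note b = GDERIV_mult[OF GDERIV_mult[OF GDERIV_radial[OF DERIV_flux_x[OF s, of "DIM('a)"]]
            GDERIV_inner_left[of e]] GDERIV_inner_left[of i]]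
      show ?thesis
        using GDERIV_add[OF a b]
        unfolding singular_flux_def J_def by (simp add: inner_add_left algebra_simps)
    qed
    show "continuous_on (ball 0 1 - {0}) (J i)" for i
      unfolding J_def flux_e'_def flux_x'_def flux_x_def
      by (intro continuous_intros continuous_on_log_power_norm)
    fix x :: 'a assume x: "x \<in> ball 0 1 - {0}"
    define s where "s = (norm x)\<^sup>2"
    have s: "0 < s" "s < 1" using norm_power2_in_unit_interval[OF x] by (auto simp: s_def)
    have sums: "(\<Sum>i\<in>Basis. (e \<bullet> i) * (x \<bullet> i)) = x \<bullet> e" "(\<Sum>i\<in>Basis. (x \<bullet> i) * (x \<bullet> i)) = s"
      "(\<Sum>i\<in>Basis. (x \<bullet> i) * (e \<bullet> i)) = x \<bullet> e"
      using euclidean_inner[of e x] euclidean_inner[of x x] euclidean_inner[of x e]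
      by (simp_all add: s_def power2_norm_eq_inner inner_commute[of e x])
    have "(\<Sum>i\<in>Basis. J i x \<bullet> i) = (\<Sum>i\<in>Basis. 2 * flux_e' DIM('a) s * ((e \<bullet> i) * (x \<bullet> i))
      + 2 * flux_x' DIM('a) s * (x \<bullet> e) * ((x \<bullet> i) * (x \<bullet> i))
      + flux_x DIM('a) s * ((x \<bullet> i) * (e \<bullet> i)) + flux_x DIM('a) s * (x \<bullet> e))"
      by (intro sum.cong refl) (simp add: J_def s_def inner_add_left inner_Basis mult_ac)
    also have "\<dots> = 2 * flux_e' DIM('a) s * (x \<bullet> e) + 2 * flux_x' DIM('a) s * (x \<bullet> e) * s
      + flux_x DIM('a) s * (x \<bullet> e) + DIM('a) * (flux_x DIM('a) s * (x \<bullet> e))"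
      by (simp only: sum.distrib sum_distrib_left[symmetric] sums sum_constant) (simp add: mult_ac)
    also have "\<dots> = (x \<bullet> e) * (2 * flux_e' DIM('a) s + (real DIM('a) + 1) * flux_x DIM('a) s
        + 2 * s * flux_x' DIM('a) s)"
      by (simp add: algebra_simps)
    also have "\<dots> = 0"
      using flux_divergence[of "DIM('a)" s] dim s(1) by simp
    finally show "(\<Sum>i\<in>Basis. J i x \<bullet> i) = 0" .
  qed
qed

section \<open>Integrability of the gradient\<close>

text \<open>The logarithm of a quantity of size at most \<open>C s^(-n/2)\<close> is at most a multiple of \<open>24 - ln s\<close>, so it
  costs only one of the three logarithmic factors of the amplitude.\<close>

lemma LlogL_pointwise_bound:
  assumes n: "0 \<le> n" and s: "0 < s" "s < 1" and C: "0 \<le> C" and r: "0 \<le> r" "r \<le> C * amplitude n s"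
  shows "r * ln (1 + r) \<le> C * (ln (1 + C) + n / 2) * log_power (- (n / 2)) 2 s"
proof -
  define T where "T = recip_log s"
  define P where "P = s powr (- (n / 2))"
  have T: "0 < T" "T \<le> 1 / 24" using recip_log_bounds[OF s] by (auto simp: T_def)
  have lns: "ln s < 0" using s by simp
  have F: "amplitude n s = P * T ^ 3"
    by (simp add: amplitude_def log_power_def P_def T_def)
  have P: "1 \<le> P" unfolding P_def using powr_mono2'[of "- (n / 2)" s 1] n s by simp
  have "T ^ 3 \<le> 1" using T by (intro power_le_one) auto
  then have "amplitude n s \<le> P * 1" unfolding F using P by (intro mult_left_mono) auto
  then have "C * amplitude n s \<le> C * P" using C by (intro mult_left_mono) auto
  then have "1 + r \<le> (1 + C) * P" using r P by (simp add: algebra_simps)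
  then have "ln (1 + r) \<le> ln ((1 + C) * P)" using r(1) by (intro ln_mono) auto
  also have "\<dots> = ln (1 + C) + n / 2 * (- ln s)"
    using C P s by (simp add: ln_mult P_def ln_powr)
  also have "\<dots> \<le> ln (1 + C) * (24 - ln s) + n / 2 * (24 - ln s)"
  proof (intro add_mono)
    have "ln (1 + C) * 1 \<le> ln (1 + C) * (24 - ln s)" using C lns by (intro mult_left_mono) auto
    then show "ln (1 + C) \<le> ln (1 + C) * (24 - ln s)" by simp
    show "n / 2 * - ln s \<le> n / 2 * (24 - ln s)" using n by (intro mult_left_mono) auto
  qed
  also have "\<dots> = (ln (1 + C) + n / 2) / T"
    using s lns by (simp add: T_def recip_log_def algebra_simps)
  finally have "r * ln (1 + r) \<le> (C * (P * T ^ 3)) * ((ln (1 + C) + n / 2) / T)"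
    using r C P T unfolding F by (intro mult_mono) auto
  also have "\<dots> = C * (ln (1 + C) + n / 2) * (P * T\<^sup>2)"
    using T by (simp add: field_simps eval_nat_numeral)
  finally show ?thesis by (simp add: log_power_def P_def T_def)
qed

lemma LlogL_singular_gradient:
  fixes e :: "'a::euclidean_space"
  assumes e: "norm e = 1"
  shows "integrable (lebesgue_on (ball 0 1))
    (\<lambda>x. norm (singular_gradient e x) * ln (1 + norm (singular_gradient e x)))"
proof (rule integrable_dominated_by_log_power)
  note [measurable] = measurable_singular[of e]
  show "(\<lambda>x. norm (singular_gradient e x) * ln (1 + norm (singular_gradient e x))) \<in> borel_measurable borel"
    by measurable
  fix x :: 'a assume x: "x \<in> ball 0 1 - {0}"
  define C where "C = real DIM('a) + 3"
  have C: "0 \<le> C" by (simp add: C_def)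
  have "norm (singular_gradient e x) * ln (1 + norm (singular_gradient e x))
      \<le> C * (ln (1 + C) + DIM('a) / 2) * log_power (- (DIM('a) / 2)) 2 ((norm x)\<^sup>2)"
    using norm_singular_gradient_le[OF e, of x] x norm_power2_in_unit_interval[OF x] C
    by (intro LlogL_pointwise_bound) (auto simp: C_def)
  then show "norm (norm (singular_gradient e x) * ln (1 + norm (singular_gradient e x)))
      \<le> (C * (ln (1 + C) + DIM('a) / 2)) * log_power (- (DIM('a) / 2)) 2 ((norm x)\<^sup>2)"
    by (simp add: ln_ge_zero)
qed

lemma amplitude_powr_tends_to_infinity:
  assumes n: "0 < n" and p: "1 < p"
  shows "filterlim (\<lambda>s. s powr (n / 2) * (3 / 4 * amplitude n s) powr p) at_top (at_right 0)"
proof -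
  define a where "a = n / 2 * (p - 1)"
  define b where "b = 3 * p"
  have ab: "0 < a" "0 < b" using n p by (auto simp: a_def b_def)
  have "filterlim (\<lambda>s::real. (3 / 4) powr p * (s powr (- a) * (24 - ln s) powr (- b))) at_top (at_right 0)"
    using ab by real_asymp
  then show ?thesis
  proof (rule filterlim_cong[THEN iffD1, rotated -1])
    have "\<forall>\<^sub>F s in at_right (0::real). s \<in> {0<..<1}"
      by (rule eventually_at_right_real) simp
    then show "\<forall>\<^sub>F s in at_right 0. (3 / 4) powr p * (s powr (- a) * (24 - ln s) powr (- b))
        = s powr (n / 2) * (3 / 4 * amplitude n s) powr p"
    proof eventually_elim
      case (elim s)
      then have s: "0 < s" "s < 1" by auto
      define L where "L = 24 - ln s"
      have L: "0 < L" using ln_less_zero[OF s] by (simp add: L_def)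
      have "amplitude n s = s powr (- (n / 2)) * L powr (- 3)"
        using s L by (simp add: amplitude_def log_power_def recip_log_def L_def powr_minus powr_numeral power_divide inverse_eq_divide)
      then have "(c * amplitude n s) powr p = c powr p * (s powr (- (n / 2) * p) * L powr (- b))" if "0 < c" for c
        using s L that by (simp add: powr_mult powr_powr b_def)
      from this[of "3 / 4"]
      have "(3 / 4 * amplitude n s) powr p = (3 / 4) powr p * (s powr (- (n / 2) * p) * L powr (- b))"
        by simp
      moreover have "s powr (n / 2) * s powr (- (n / 2) * p) = s powr (- a)"
      proof -
        have "n / 2 + - (n / 2) * p = - a" by (simp add: a_def field_simps)
        then show ?thesis by (simp only: powr_add[symmetric])
      qed
      ultimately show ?case by (simp add: L_def mult_ac)
    qed
  qed simp_all
qed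

text \<open>The integral over one small ball is already as large as desired: if \<open>|\<nabla>u|\<^sup>p \<ge> M |x|^(-n)\<close> for \<open>|x| < \<epsilon>\<close>,
  then the integral over the ball of radius \<open>\<epsilon>\<close> is at least \<open>M \<epsilon>^(-n)\<close> times the volume of that ball, which is
  \<open>M\<close> times the volume of the unit ball, and \<open>M\<close> is arbitrary because the power beats the logarithm.\<close>

lemma singular_gradient_not_Lp:
  fixes e :: "'a::euclidean_space"
  assumes e: "norm e = 1" and dim: "2 \<le> DIM('a)" and p: "1 < p"
  shows "\<not> integrable (lebesgue_on (cball 0 (1 / 2))) (\<lambda>x. norm (singular_gradient e x) powr p)"
proof
  define K where "K = cball (0::'a) (1 / 2)"
  define g where "g x = norm (singular_gradient e x) powr p" for x
  define n where "n = DIM('a)"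
  define V where "V = measure lborel (ball (0::'a) 1)"
  assume "integrable (lebesgue_on (cball 0 (1 / 2))) (\<lambda>x. norm (singular_gradient e x) powr p)"
  then have int: "integrable (lebesgue_on K) g" by (simp add: K_def g_def[abs_def])
  define I where "I = integral\<^sup>L (lebesgue_on K) g"
  have V: "0 < V" unfolding V_def by (rule content_ball_pos) simp
  \<comment> \<open>With this constant the ball of radius \<open>\<epsilon>\<close> contributes at least \<open>\<bar>I\<bar> + 1\<close>, more than the whole integral.\<close>
  define M where "M = (\<bar>I\<bar> + 1) / V"
  have M: "0 < M" using V by (simp add: M_def)
  have "\<forall>\<^sub>F s in at_right 0. M \<le> s powr (n / 2) * (3 / 4 * amplitude n s) powr p"
    using amplitude_powr_tends_to_infinity[of "real n" p] dim p
    by (auto simp: filterlim_at_top n_def)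
  then obtain \<delta> where \<delta>: "0 < \<delta>"
    and big: "\<And>s. 0 < s \<Longrightarrow> s < \<delta> \<Longrightarrow> M \<le> s powr (n / 2) * (3 / 4 * amplitude n s) powr p"
    unfolding eventually_at_right_field by blast
  define \<epsilon> where "\<epsilon> = min (1 / 2) (sqrt \<delta>)"
  have \<epsilon>: "0 < \<epsilon>" "\<epsilon> \<le> 1 / 2" "\<epsilon>\<^sup>2 \<le> \<delta>"
    using \<delta> power_mono[of "min (1 / 2) (sqrt \<delta>)" "sqrt \<delta>" 2] by (auto simp: \<epsilon>_def)
  have sub: "ball 0 \<epsilon> \<subseteq> K" using \<epsilon> by (auto simp: K_def)
  have g_ge: "M / \<epsilon> ^ n \<le> g x" if x: "x \<in> ball 0 \<epsilon>" "x \<noteq> 0" for x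
  proof -
    define s where "s = (norm x)\<^sup>2"
    have "x \<in> ball 0 1 - {0}" using x \<epsilon> by auto
    note lower = norm_singular_gradient_ge[OF e this dim] and s01 = norm_power2_in_unit_interval[OF this]
    have s: "0 < s" "s < 1" using s01 by (auto simp: s_def)
    have "s < \<epsilon>\<^sup>2" unfolding s_def using x \<epsilon> by (intro power_strict_mono) auto
    then have "s < \<delta>" using \<epsilon> by simp
    have "s powr (n / 2) = norm x ^ n"
      using x by (simp add: s_def powr_powr flip: powr_realpow powr_numeral)
    then have sn: "0 < s powr (n / 2)" "s powr (n / 2) \<le> \<epsilon> ^ n"
      using x \<epsilon> by (auto intro!: power_mono)
    have "M / \<epsilon> ^ n \<le> M / s powr (n / 2)"
      using sn M \<epsilon> by (intro divide_left_mono) auto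
    also have "\<dots> \<le> (3 / 4 * amplitude n s) powr p"
      using big[OF s(1) \<open>s < \<delta>\<close>] sn(1) by (simp add: field_simps)
    also have "\<dots> \<le> g x"
      unfolding g_def using lower amplitude_bounds(1)[OF s, THEN less_imp_le] p
      by (intro powr_mono2) (auto simp: s_def n_def)
    finally show ?thesis .
  qed
  have "(\<integral>x. indicator (ball 0 \<epsilon>) x * (M / \<epsilon> ^ n) \<partial>(lebesgue :: 'a measure)) = measure lborel (ball (0::'a) \<epsilon>) * (M / \<epsilon> ^ n)"
    by simp
  also have "measure lborel (ball (0::'a) \<epsilon>) = \<epsilon> ^ n * V"
    unfolding V_def n_def using \<epsilon> by (intro content_ball_conv_unit_ball) simp
  also have "\<epsilon> ^ n * V * (M / \<epsilon> ^ n) = \<bar>I\<bar> + 1" using \<epsilon> V by (simp add: M_def)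
  finally have "\<bar>I\<bar> + 1 = (\<integral>x. indicator (ball 0 \<epsilon>) x * (M / \<epsilon> ^ n) \<partial>(lebesgue :: 'a measure))" by simp
  also have "\<dots> \<le> (\<integral>x. (if x \<in> K then g x else 0) \<partial>lebesgue)"
  proof (rule integral_mono_AE)
    have "ball (0::'a) \<epsilon> \<in> lmeasurable" by simp
    then show "integrable lebesgue (\<lambda>x. indicator (ball (0::'a) \<epsilon>) x * (M / \<epsilon> ^ n))"
      by (simp add: fmeasurable_def)
    show "integrable lebesgue (\<lambda>x. if x \<in> K then g x else 0)"
      using int Lebesgue_Measure.integrable_restrict_UNIV[of K g] by (simp add: K_def)
    show "AE x in lebesgue. indicator (ball 0 \<epsilon>) x * (M / \<epsilon> ^ n) \<le> (if x \<in> K then g x else 0)"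
      using AE_lebesgue_neq_0
    proof eventually_elim
      case (elim x)
      then show ?case using g_ge[of x] sub by (auto simp: indicator_def g_def)
    qed
  qed
  also have "\<dots> = I"
    unfolding I_def by (rule Lebesgue_Measure.integral_restrict_UNIV) (simp add: K_def)
  finally show False by simp
qed

lemma singular_solution_not_W1p_loc:
  fixes e :: "'a::euclidean_space"
  assumes e: "norm e = 1" and dim: "2 \<le> DIM('a)" and p: "1 < p"
  shows "singular_solution e \<notin> W1p_loc p (ball 0 1)"
proof
  assume "singular_solution e \<in> W1p_loc p (ball 0 1)"
  then obtain g where g: "g \<in> Lp_loc p (ball 0 1)" "has_weak_gradient (ball 0 1) (singular_solution e) g"
    unfolding W1p_loc_def by blast
  define K where "K = cball (0::'a) (1 / 2)"
  have K: "compact K" "K \<subseteq> ball 0 1" by (auto simp: K_def)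
  have "AE x in lebesgue_on (ball 0 1). g x = singular_gradient e x"
    by (rule has_weak_gradient_unique[OF open_ball g(2) has_weak_gradient_singular[OF e dim]])
  then have "AE x in lebesgue_on K. g x = singular_gradient e x"
    using K by (subst (asm) AE_restrict_space_iff, simp, subst AE_restrict_space_iff)
      (auto simp: compact_imp_closed elim!: eventually_mono)
  then have ae: "AE x in lebesgue_on K. norm (g x) powr p = norm (singular_gradient e x) powr p"
    by eventually_elim simp
  have int: "integrable (lebesgue_on K) (\<lambda>x. norm (g x) powr p)"
    using g(1) K unfolding Lp_loc_def by blast
  note [measurable] = measurable_singular[of e]
  have "(\<lambda>x. norm (singular_gradient e x) powr p) \<in> borel_measurable (lebesgue_on K)"
    by (rule borel_imp_lebesgue_on_measurable) measurable
  then have "integrable (lebesgue_on K) (\<lambda>x. norm (singular_gradient e x) powr p)"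
    using int ae by (subst integrable_cong_AE[where g = "\<lambda>x. norm (g x) powr p"]) (auto elim!: eventually_mono)
  then show False using singular_gradient_not_Lp[OF e dim p] by (simp add: K_def)
qed

section \<open>The coefficient matrix\<close>

text \<open>At the origin the division by zero makes the second summand vanish, and \<open>tangential_coeff\<close> is 1, so
  the value there is the identity matrix.\<close>

definition coefficient_matrix :: "real^'n \<Rightarrow> real^'n^'n" where
  "coefficient_matrix x = tangential_coeff CARD('n) ((norm x)\<^sup>2) *\<^sub>R mat 1
     + ((1 - tangential_coeff CARD('n) ((norm x)\<^sup>2)) / (norm x)\<^sup>2) *\<^sub>R (\<chi> i j. x $ i * x $ j)"

lemma outer_product_mult_vec: "(\<chi> i j. x $ i * x $ j) *v \<xi> = (x \<bullet> \<xi>) *\<^sub>R (x :: real^'n)"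
  by (simp add: matrix_vector_mult_def vec_eq_iff inner_vec_def sum_distrib_left mult_ac)

lemma coefficient_matrix_mult_vec:
  fixes x :: "real^'n"
  shows "coefficient_matrix x *v \<xi> = tangential_coeff CARD('n) ((norm x)\<^sup>2) *\<^sub>R \<xi>
     + ((1 - tangential_coeff CARD('n) ((norm x)\<^sup>2)) / (norm x)\<^sup>2 * (x \<bullet> \<xi>)) *\<^sub>R x"
  unfolding coefficient_matrix_def
  by (simp add: matrix_vector_mult_add_rdistrib scaleR_matrix_vector_assoc[symmetric] outer_product_mult_vec)

lemma coefficient_matrix_singular_gradient:
  fixes x e :: "real^'n"
  assumes "x \<in> ball 0 1 - {0}"
  shows "coefficient_matrix x *v singular_gradient e x = singular_flux e x"
proof -
  define s where "s = (norm x)\<^sup>2"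
  have s: "0 < s" using norm_power2_in_unit_interval[OF assms] by (simp add: s_def)
  define n where "n = real CARD('n)"
  have dim: "real DIM(real^'n) = n" by (simp add: n_def)
  have xg: "x \<bullet> singular_gradient e x = (x \<bullet> e) * (amplitude n s + 2 * s * amplitude' n s)"
    unfolding singular_gradient_def dim s_def[symmetric]
    by (simp add: inner_add_right s_def power2_norm_eq_inner algebra_simps)
  have "coefficient_matrix x *v singular_gradient e x
    = (tangential_coeff n s * amplitude n s) *\<^sub>R e + ((2 * tangential_coeff n s * amplitude' n s
      + (1 - tangential_coeff n s) / s * (amplitude n s + 2 * s * amplitude' n s)) * (x \<bullet> e)) *\<^sub>R x"
    unfolding coefficient_matrix_mult_vec xg n_def[symmetric] s_def[symmetric]
    unfolding singular_gradient_def dim s_def[symmetric]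
    by (simp add: algebra_simps)
  then have "coefficient_matrix x *v singular_gradient e x = flux_e n s *\<^sub>R e + (flux_x n s * (x \<bullet> e)) *\<^sub>R x"
    unfolding tangential_coeff_amplitude[OF s] flux_x_eq[OF s] .
  then show ?thesis by (simp add: singular_flux_def n_def s_def)
qed

text \<open>The direction \<open>x / |x|\<close> has no limit at the origin, but it enters with the factor \<open>1 - tangential_coeff\<close>,
  which tends to zero there.\<close>

lemma continuous_on_coefficient_matrix:
  "continuous_on (ball 0 1) (coefficient_matrix :: real^'n \<Rightarrow> real^'n^'n)"
proof -
  define b where "b x = tangential_coeff CARD('n) ((norm x)\<^sup>2)" for x :: "real^'n"
  have "continuous_on (ball 0 1) (\<lambda>x::real^'n. recip_log ((norm x)\<^sup>2))"
    by (rule continuous_on_compose2[OF continuous_on_recip_log, of _ "\<lambda>x. (norm x)\<^sup>2"])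
      (auto intro!: continuous_intros simp: power_less_one_iff)
  then have cb: "continuous_on (ball 0 1) b"
    unfolding b_def tangential_coeff_def by (intro continuous_intros)
  have b0: "b 0 = 1" by (simp add: b_def tangential_coeff_def recip_log_def)
  define w where "w i j x = (1 - b x) / (norm x)\<^sup>2 * (x $ i * x $ j)" for i j and x :: "real^'n"
  have "continuous_on (ball 0 1) (w i j)" for i j
  proof (intro continuous_at_imp_continuous_on ballI)
    fix x :: "real^'n" assume x: "x \<in> ball 0 1"
    have isb: "isCont b x" if "x \<in> ball 0 1" for x
      using cb that by (simp add: continuous_on_eq_continuous_at)
    show "isCont (w i j) x"
    proof (cases "x = 0")
      case False
      then show ?thesis unfolding w_def using isb[OF x] by (intro continuous_intros) auto
    next
      case True
      have "(b \<longlongrightarrow> b 0) (at 0)" using isb[of 0] by (simp add: isCont_def)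
      then have lim: "((\<lambda>x. \<bar>1 - b x\<bar>) \<longlongrightarrow> 0) (at 0)"
        using tendsto_rabs[OF tendsto_diff[OF tendsto_const[of 1]]] b0 by fastforce
      have w_le: "norm (w i j x) \<le> \<bar>1 - b x\<bar>" for x
      proof (cases "x = 0")
        case nz: False
        have "\<bar>x $ i\<bar> * \<bar>x $ j\<bar> \<le> norm x * norm x"
          by (intro mult_mono component_le_norm_cart) auto
        then have "\<bar>x $ i * x $ j\<bar> / (norm x)\<^sup>2 \<le> 1"
          using nz by (simp add: abs_mult power2_eq_square divide_le_eq)
        then have "\<bar>1 - b x\<bar> * (\<bar>x $ i * x $ j\<bar> / (norm x)\<^sup>2) \<le> \<bar>1 - b x\<bar> * 1"
          by (intro mult_left_mono) auto
        then show ?thesis by (simp add: w_def abs_mult)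
      qed (simp add: w_def)
      have "(w i j \<longlongrightarrow> 0) (at 0)"
        by (rule Lim_null_comparison[OF always_eventually[OF allI[OF w_le]] lim])
      then show ?thesis using True by (simp add: isCont_def w_def)
    qed
  qed
  then have "continuous_on (ball 0 1) (\<lambda>x. \<chi> i j. b x * (if i = j then 1 else 0) + w i j x)"
    by (intro continuous_intros cb)
  moreover have "coefficient_matrix x = (\<chi> i j. b x * (if i = j then 1 else 0) + w i j x)" for x :: "real^'n"
    by (simp add: coefficient_matrix_def vec_eq_iff mat_def b_def w_def)
  ultimately show ?thesis by simp
qed

lemma coefficient_matrix_quadratic_form:
  fixes x \<xi> :: "real^'n"
  assumes n: "2 \<le> CARD('n)" and x: "x \<in> ball 0 1"
  shows "1 / 2 * (norm \<xi>)\<^sup>2 \<le> (coefficient_matrix x *v \<xi>) \<bullet> \<xi>"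
    and "(coefficient_matrix x *v \<xi>) \<bullet> \<xi> \<le> 2 * (norm \<xi>)\<^sup>2"
proof -
  define b where "b = tangential_coeff CARD('n) ((norm x)\<^sup>2)"
  define \<tau> where "\<tau> = (x \<bullet> \<xi>)\<^sup>2 / (norm x)\<^sup>2"
  have b: "1 / 2 \<le> b" "b \<le> 2"
    unfolding b_def using tangential_coeff_bounds[of "real CARD('n)" "(norm x)\<^sup>2"] n x
    by (auto simp: power_less_one_iff)
  have "(coefficient_matrix x *v \<xi>) \<bullet> \<xi> = b * (norm \<xi>)\<^sup>2 + (1 - b) * \<tau>"
    unfolding coefficient_matrix_mult_vec b_def[symmetric] \<tau>_def
    by (simp add: inner_add_left power2_norm_eq_inner[of \<xi>] power2_eq_square[of "x \<bullet> \<xi>"])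
  then have eq: "(coefficient_matrix x *v \<xi>) \<bullet> \<xi> = b * ((norm \<xi>)\<^sup>2 - \<tau>) + \<tau>"
    by (simp add: algebra_simps)
  have \<tau>: "0 \<le> \<tau>" "\<tau> \<le> (norm \<xi>)\<^sup>2"
  proof -
    have "(x \<bullet> \<xi>)\<^sup>2 \<le> (norm x * norm \<xi>)\<^sup>2"
      using Cauchy_Schwarz_ineq2[of x \<xi>] power_mono[of "\<bar>x \<bullet> \<xi>\<bar>" _ 2] by simp
    then show "\<tau> \<le> (norm \<xi>)\<^sup>2"
      by (cases "x = 0") (auto simp: \<tau>_def power_mult_distrib divide_le_eq mult.commute)
    show "0 \<le> \<tau>" by (simp add: \<tau>_def)
  qed
  have "1 / 2 * ((norm \<xi>)\<^sup>2 - \<tau>) \<le> b * ((norm \<xi>)\<^sup>2 - \<tau>)" "b * ((norm \<xi>)\<^sup>2 - \<tau>) \<le> 2 * ((norm \<xi>)\<^sup>2 - \<tau>)"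
    using b \<tau> by (intro mult_right_mono; simp)+
  then show "1 / 2 * (norm \<xi>)\<^sup>2 \<le> (coefficient_matrix x *v \<xi>) \<bullet> \<xi>"
    and "(coefficient_matrix x *v \<xi>) \<bullet> \<xi> \<le> 2 * (norm \<xi>)\<^sup>2"
    unfolding eq using \<tau> by (simp_all add: algebra_simps)
qed

lemma elliptic_coefficient_matrix:
  assumes n: "2 \<le> CARD('n::finite)"
  shows "elliptic (ball 0 1) (coefficient_matrix :: real^'n \<Rightarrow> real^'n^'n)"
  unfolding elliptic_def
proof (intro conjI ballI)
  let ?A = "coefficient_matrix :: real^'n \<Rightarrow> real^'n^'n"
  show "?A \<in> borel_measurable (lebesgue_on (ball 0 1))"
    by (rule continuous_imp_measurable_on_sets_lebesgue[OF continuous_on_coefficient_matrix]) simp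
  have sym: "coefficient_matrix x $ i $ j = coefficient_matrix x $ j $ i" for x :: "real^'n" and i j
    by (simp add: coefficient_matrix_def mat_def mult.commute)
  show "transpose (?A x) = ?A x" for x
    by (simp add: transpose_def vec_eq_iff sym)
  show "bounded (?A ` ball 0 1)"
    unfolding bounded_iff
  proof (intro exI ballI)
    fix M assume "M \<in> ?A ` ball 0 1"
    then obtain x where x: "x \<in> ball 0 1" "M = ?A x" by blast
    define b where "b = tangential_coeff CARD('n) ((norm x)\<^sup>2)"
    have b: "1 / 2 \<le> b" "b \<le> 2"
      unfolding b_def using tangential_coeff_bounds[of "real CARD('n)" "(norm x)\<^sup>2"] n x
    by (auto simp: power_less_one_iff)
    have entry: "\<bar>M $ i $ j\<bar> \<le> 3" for i j
    proof -
      have 1: "\<bar>x $ i\<bar> * \<bar>x $ j\<bar> \<le> norm x * norm x"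
        by (intro mult_mono component_le_norm_cart) auto
      have "\<bar>x $ i * x $ j\<bar> / (norm x)\<^sup>2 \<le> 1"
        using 1 by (cases "x = 0") (auto simp: abs_mult power2_eq_square divide_le_eq)
      then have "\<bar>1 - b\<bar> * (\<bar>x $ i * x $ j\<bar> / (norm x)\<^sup>2) \<le> 1 * 1"
        using b by (intro mult_mono) auto
      moreover have "M $ i $ j = b * (if i = j then 1 else 0) + (1 - b) / (norm x)\<^sup>2 * (x $ i * x $ j)"
        by (simp add: x coefficient_matrix_def mat_def b_def)
      then have "\<bar>M $ i $ j\<bar> \<le> \<bar>b * (if i = j then 1 else 0)\<bar> + \<bar>1 - b\<bar> * (\<bar>x $ i * x $ j\<bar> / (norm x)\<^sup>2)"
        using abs_triangle_ineq[of "b * (if i = j then 1 else 0)" "(1 - b) / (norm x)\<^sup>2 * (x $ i * x $ j)"]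
        by (simp add: abs_mult)
      moreover have "\<bar>b * (if i = j then 1 else 0)\<bar> \<le> 2" using b by auto
      ultimately show ?thesis by linarith
    qed
    have "norm M \<le> (\<Sum>i\<in>UNIV. norm (M $ i))" 
      unfolding norm_vec_def by (rule L2_set_le_sum) simp
    also have "\<dots> \<le> (\<Sum>i\<in>(UNIV::'n set). \<Sum>j\<in>(UNIV::'n set). 3)"
      using entry by (intro sum_mono order_trans[OF norm_le_l1_cart]) auto
    finally show "norm M \<le> (\<Sum>i\<in>(UNIV::'n set). \<Sum>j\<in>(UNIV::'n set). 3)" .
  qed
  have "\<forall>x\<in>ball 0 1. \<forall>\<xi>. 1 / 2 * (norm \<xi>)\<^sup>2 \<le> (?A x *v \<xi>) \<bullet> \<xi> \<and> (?A x *v \<xi>) \<bullet> \<xi> \<le> 2 * (norm \<xi>)\<^sup>2"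
    using coefficient_matrix_quadratic_form[OF n] by blast
  moreover have "(0 :: real) < 1 / 2" "(0 :: real) < 2" by simp_all
  ultimately show "\<exists>l>0. \<exists>L>0. \<forall>x\<in>ball 0 1. \<forall>\<xi>. l * (norm \<xi>)\<^sup>2 \<le> (?A x *v \<xi>) \<bullet> \<xi>
      \<and> (?A x *v \<xi>) \<bullet> \<xi> \<le> L * (norm \<xi>)\<^sup>2"
    by blast
qed

theorem proposition1p4:
  assumes "2 \<le> CARD('n::finite)"
  shows "\<exists>(u :: real^'n \<Rightarrow> real) (A :: real^'n \<Rightarrow> real^'n^'n).
    u \<in> W1p_loc 1 (ball 0 1) \<and>
    continuous_on (ball 0 1) A \<and> elliptic (ball 0 1) A \<and>
    weak_solution (ball 0 1) A u \<and>
    weak_gradient (ball 0 1) u \<in> LlogL_loc (ball 0 1) \<and>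
    (\<forall>p>1. u \<notin> W1p_loc p (ball 0 1))"
proof -
  let ?B = "ball 0 1 :: (real^'n) set"
  obtain e :: "real^'n" where "e \<in> Basis" using nonempty_Basis by blast
  then have e: "norm e = 1" by simp
  have dim: "2 \<le> DIM(real^'n)" using assms by simp
  define u where "u = singular_solution e"
  define A where "A = (coefficient_matrix :: real^'n \<Rightarrow> real^'n^'n)"
  define g where "g = weak_gradient ?B u"
  have grad: "has_weak_gradient ?B u (singular_gradient e)"
    unfolding u_def by (rule has_weak_gradient_singular[OF e dim])
  then have g: "has_weak_gradient ?B u g"
    unfolding g_def weak_gradient_def by (rule someI[where P = "has_weak_gradient ?B u"])
  have ae: "AE x in lebesgue_on ?B. g x = singular_gradient e x"
    by (rule has_weak_gradient_unique[OF open_ball g grad])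
  have g_meas: "g \<in> borel_measurable (lebesgue_on ?B)"
    using g by (simp add: has_weak_gradient_def Lp_loc_def)
  have contA: "continuous_on ?B A" unfolding A_def by (rule continuous_on_coefficient_matrix)
  have W1: "u \<in> W1p_loc 1 ?B"
    using grad unfolding W1p_loc_def has_weak_gradient_def by blast
  have "weak_solution ?B A u"
    unfolding weak_solution_def g_def[symmetric]
  proof (intro conjI W1 ballI)
    fix \<phi> :: "real^'n \<Rightarrow> real" assume \<phi>: "\<phi> \<in> C1c ?B"
    have "(\<integral>x. (A x *v g x) \<bullet> gradient \<phi> x \<partial>lebesgue_on ?B)
        = (\<integral>x. singular_flux e x \<bullet> gradient \<phi> x \<partial>lebesgue_on ?B)"
    proof (rule integral_cong_AE)
      have \<phi>_meas: "gradient \<phi> \<in> borel_measurable (lebesgue_on ?B)"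
        by (intro measurable_restrict_space1 continuous_imp_lebesgue_measurable C1c_continuous(2)[OF \<phi>])
      have A_meas: "A \<in> borel_measurable (lebesgue_on ?B)"
        by (rule continuous_imp_measurable_on_sets_lebesgue[OF contA]) simp
      have "continuous_on UNIV (\<lambda>z :: (real^'n^'n) \<times> (real^'n). fst z *v snd z)"
        unfolding matrix_vector_mult_def by (intro continuous_intros)
      then have "(\<lambda>x. A x *v g x) \<in> borel_measurable (lebesgue_on ?B)"
        by (rule borel_measurable_continuous_Pair[OF A_meas g_meas])
      then show "(\<lambda>x. (A x *v g x) \<bullet> gradient \<phi> x) \<in> borel_measurable (lebesgue_on ?B)"
        by (rule borel_measurable_inner[OF _ \<phi>_meas])
      show "(\<lambda>x. singular_flux e x \<bullet> gradient \<phi> x) \<in> borel_measurable (lebesgue_on ?B)"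
        by (rule borel_measurable_inner[OF borel_imp_lebesgue_on_measurable[OF measurable_singular(3)] \<phi>_meas])
      have "AE x in lebesgue_on ?B. x \<in> ?B - {0}"
        using AE_lebesgue_neq_0 by (subst AE_restrict_space_iff) (auto elim: eventually_mono)
      with ae show "AE x in lebesgue_on ?B. (A x *v g x) \<bullet> gradient \<phi> x = singular_flux e x \<bullet> gradient \<phi> x"
        by eventually_elim (simp add: A_def coefficient_matrix_singular_gradient)
    qed
    then show "(\<integral>x. (A x *v g x) \<bullet> gradient \<phi> x \<partial>lebesgue_on ?B) = 0"
      using singular_flux_weakly_divergence_free[OF e dim \<phi>] by simp
  qed
  moreover have "g \<in> LlogL_loc ?B"
    unfolding LlogL_loc_def
  proof (intro CollectI conjI g_meas allI impI)
    fix K assume K: "compact K \<and> K \<subseteq> ?B"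
    have "integrable (lebesgue_on ?B) (\<lambda>x. norm (g x) * ln (1 + norm (g x)))"
    proof (rule integrable_cong_AE_imp[OF LlogL_singular_gradient[OF e]])
      show "(\<lambda>x. norm (g x) * ln (1 + norm (g x))) \<in> borel_measurable (lebesgue_on ?B)"
        using g_meas by measurable
      show "AE x in lebesgue_on ?B. norm (singular_gradient e x) * ln (1 + norm (singular_gradient e x))
          = norm (g x) * ln (1 + norm (g x))"
        using ae by eventually_elim simp
    qed
    then show "integrable (lebesgue_on K) (\<lambda>x. norm (g x) * ln (1 + norm (g x)))"
      by (rule integrable_lebesgue_on_subset) (use K in \<open>auto simp: compact_imp_closed\<close>)
  qed
  ultimately show ?thesis
    using W1 contA elliptic_coefficient_matrix[OF assms] singular_solution_not_W1p_loc[OF e dim]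
    unfolding g_def u_def A_def by blast
qed

end
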